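(* Fix $k_0\in\mathbb{N}$, an integer $k$ with $1\le k\le k_0$, and $U\in(0,\pi/4)$. For $L\in\mathbb{N}$ let $$f_1(t)=t\sin^2 t,\quad f_2(t)=t\cos^2 t,\quad f_3(t)=t\cos(2t),\qquad t\in[\pi L,\pi L+U].$$ For all sufficiently large $L$ there exist $\zeta$-factorization points $\alpha_0^{i,k},\alpha_1^{i,k},\dots,\alpha_k^{i,k}$ generated by $f_i$, $i=1,2,3$ (with associated points $\beta_1^k,\dots,\beta_k^k$ common to $i=1,2,3$), in the sense defined in the context with $T=\pi L$, such that $$\left\{\prod_{r=1}^k\left|\zeta\left(\tfrac12+i\alpha_r^{2,k}\right)\right|^2\right\}\cos^2\alpha_0^{2,k}-\left\{\prod_{r=1}^k\left|\zeta\left(\tfrac12+i\alpha_r^{1,k}\right)\right|^2\right\}\sin^2\alpha_0^{1,k}\sim\left\{\prod_{r=1}^k\left|\zeta\left(\tfrac12+i\alpha_r^{3,k}\right)\right|^2\right\}\cos(2\alpha_0^{3,k}),\quad L\to\infty.$$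
   Context: Here $A\sim B$ as $L\to\infty$ means $A/B\to1$; inside the argument of $\zeta$ the letter $i$ is the imaginary unit, while as a superscript it is an index. Jacob's ladder. Let $\zeta$ be the Riemann zeta-function and $Z^2(t)=|\zeta(\tfrac12+it)|^2$. Fix a smooth increasing function $\mu(y)\ge 7y\ln y$ (for instance $\mu(y)=7y\ln y$) and let $\varphi(T)$ be the solution $x(T)=\varphi(T)$, for large $T$, of the nonlinear integral equation $$\int_0^{\mu[x(T)]}Z^2(t)\,e^{-\frac{2t}{x(T)}}\,dt=\int_0^T Z^2(t)\,dt .$$ The Jacob's ladder is $\varphi_1(t)=\tfrac12\varphi(t)$; for all sufficiently large $t$ it is smooth, strictly increasing and unbounded. Put $$\tilde Z^2(t)=\frac{d\varphi_1(t)}{dt}=\frac{|\zeta(\frac12+it)|^2}{\omega(t)},\qquad \omega(t)=\left\{1+O\left(\frac{\ln\ln t}{\ln t}\right)\right\}\ln t .$$ Reverse iterations. For sufficiently large $x$, the $r$-th reverse iterate $[x]^{(r)}$ of $x$ by $\varphi_1$ is defined by $[x]^{(0)}=x$ and $\varphi_1([x]^{(r)})=[x]^{(r-1)}$, $r\ge1$. (The paper writes $\overset{r}{x}$ with an arc for $[x]^{(r)}$.) $\zeta$-factorization points. Let $f$ be a continuous, non-negative, not identically zero function on $[T,T+U]$ and $k\in\mathbb{N}$. Points $\alpha_r=\alpha_r(U,T,k;f)$, $r=0,1,\dots,k$, depending on $U,T,k,f$, together with points $\beta_r=\beta_r(U,T,k)$, $r=1,\dots,k$, depending only on $U,T,k$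 (not on $f$), are called $\zeta$-factorization points generated by $f$ if $\alpha_0\in(T,T+U)$, $\alpha_r,\beta_r\in([T]^{(r)},[T+U]^{(r)})$ for $r=1,\dots,k$, $f(\alpha_0)\neq0$, $\tilde Z^2(\beta_r)\ne0$, and $$\prod_{r=1}^{k}\frac{\tilde Z^2(\alpha_r)}{\tilde Z^2(\beta_r)}=\frac{1}{f(\alpha_0)}\cdot\frac1U\int_T^{T+U}f(t)\,dt .$$ *)

theory Defs
  imports "HOL-Complex_Analysis.Complex_Analysis" "HOL-Library.Landau_Symbols"
begin

(* The analytic continuation of the Dirichlet series to the plane punctured at 1.
   It is unique there by the identity theorem; the value at 1 is irrelevant. *)
definition riemann_zeta :: "complex \<Rightarrow> complex" where
  "riemann_zeta = (SOME f. f holomorphic_on (- {1}) \<and>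
     (\<forall>s. Re s > 1 \<longrightarrow> (\<lambda>n. of_nat (Suc n) powr (- s)) sums f s))"

definition zeta_sq :: "real \<Rightarrow> real" where
  "zeta_sq t = (cmod (riemann_zeta (1/2 + \<i> * of_real t)))\<^sup>2"

definition smooth_beyond :: "real \<Rightarrow> (real \<Rightarrow> real) \<Rightarrow> bool" where
  "smooth_beyond y0 \<mu> \<longleftrightarrow> (\<forall>n. \<forall>y>y0. (deriv ^^ n) \<mu> field_differentiable (at y))"

(* The weight only matters for large arguments, so its domain is a ray {y0<..}. *)
definition ladder_weight :: "real \<Rightarrow> (real \<Rightarrow> real) \<Rightarrow> bool" where
  "ladder_weight y0 \<mu> \<longleftrightarrow> y0 > 0 \<and> smooth_beyond y0 \<mu> \<and> mono_on {y0<..} \<mu> \<and>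
     (\<forall>y>y0. \<mu> y \<ge> 7 * y * ln y)"

(* On the domain of the weight the left-hand side is strictly increasing in \<phi> T, so the
   equation determines \<phi> T. *)
definition solves_ladder_equation :: "real \<Rightarrow> (real \<Rightarrow> real) \<Rightarrow> (real \<Rightarrow> real) \<Rightarrow> bool" where
  "solves_ladder_equation y0 \<mu> \<phi> \<longleftrightarrow> (\<forall>\<^sub>F T in at_top. \<phi> T > y0 \<and>
     integral {0..\<mu> (\<phi> T)} (\<lambda>t. zeta_sq t * exp (- (2 * t / \<phi> T))) = integral {0..T} zeta_sq)"

definition jacobs_ladder :: "(real \<Rightarrow> real) \<Rightarrow> real \<Rightarrow> real" where
  "jacobs_ladder \<phi> t = \<phi> t / 2"

definition tilde_zeta_sq :: "(real \<Rightarrow> real) \<Rightarrow> real \<Rightarrow> real" where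
  "tilde_zeta_sq \<phi> = deriv (jacobs_ladder \<phi>)"

(* t0 is a point beyond which the ladder is strictly increasing; for large x the iterates do
   not depend on its choice. *)
definition reverse_iterate :: "(real \<Rightarrow> real) \<Rightarrow> real \<Rightarrow> nat \<Rightarrow> real \<Rightarrow> real" where
  "reverse_iterate \<phi> t0 r x = (inv_into {t0..} (jacobs_ladder \<phi>) ^^ r) x"

definition zeta_factorization_points ::
  "(real \<Rightarrow> real) \<Rightarrow> real \<Rightarrow> real \<Rightarrow> real \<Rightarrow> nat \<Rightarrow> (real \<Rightarrow> real) \<Rightarrow>
   (nat \<Rightarrow> real) \<Rightarrow> (nat \<Rightarrow> real) \<Rightarrow> bool" where
  "zeta_factorization_points \<phi> t0 U T k f \<alpha> \<beta> \<longleftrightarrow>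
     continuous_on {T..T+U} f \<and> (\<forall>t\<in>{T..T+U}. f t \<ge> 0) \<and> (\<exists>t\<in>{T..T+U}. f t \<noteq> 0) \<and>
     \<alpha> 0 \<in> {T<..<T+U} \<and>
     (\<forall>r\<in>{1..k}. \<alpha> r \<in> {reverse_iterate \<phi> t0 r T<..<reverse_iterate \<phi> t0 r (T+U)} \<and>
                 \<beta> r \<in> {reverse_iterate \<phi> t0 r T<..<reverse_iterate \<phi> t0 r (T+U)}) \<and>
     f (\<alpha> 0) \<noteq> 0 \<and> (\<forall>r\<in>{1..k}. tilde_zeta_sq \<phi> (\<beta> r) \<noteq> 0) \<and>
     (\<Prod>r=1..k. tilde_zeta_sq \<phi> (\<alpha> r) / tilde_zeta_sq \<phi> (\<beta> r)) =
       1 / f (\<alpha> 0) * (1 / U * integral {T..T+U} f)"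

end

theory Submission
  imports Defs "HOL-Real_Asymp.Real_Asymp"
begin

text \<open>Write \<open>\<Phi>\<close> for the ladder, \<open>T = \<pi> L\<close>, and \<open>len\<close> for the length of the \<open>k\<close>-th reverse iterate of
  \<open>[T, T + U]\<close>. If \<open>H\<close> is a primitive of \<open>f\<close>, the mean value theorem for \<open>H\<close> composed with the
  \<open>k\<close>-fold iterate of \<open>\<Phi>\<close> produces a point \<open>\<alpha>\<^sub>k\<close> whose images \<open>\<alpha>\<^sub>r = \<Phi> \<alpha>\<^sub>r\<^sub>+\<^sub>1\<close> satisfy
  \<open>\<integral> f = len * f \<alpha>\<^sub>0 * \<Prod>\<^sub>r \<Phi>' \<alpha>\<^sub>r\<close>. For \<open>f = 1\<close> this produces the points \<open>\<beta>\<^sub>r\<close>, and the quotient of the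
  two identities is the factorization formula (\<open>iterated_mean_value\<close>,
  \<open>factorization_points_exist\<close>).

  Since \<open>|\<zeta>|\<^sup>2 = \<Phi>' * \<omega>\<close> on the critical line, the same identity reads
  \<open>len * f \<alpha>\<^sub>0 * \<Prod>\<^sub>r |\<zeta>|\<^sup>2 = (\<Prod>\<^sub>r \<omega> \<alpha>\<^sub>r) * \<integral> f\<close>. For \<open>f t = t * g t\<close> with \<open>g\<close> of period \<open>\<pi>\<close>, the factor
  \<open>\<alpha>\<^sub>0\<close> is asymptotic to \<open>T\<close>, and each \<open>\<omega> \<alpha>\<^sub>r\<close> is asymptotic to \<open>ln T\<close>; hence
  \<open>len / (ln T)\<^sup>k * \<Prod>\<^sub>r |\<zeta>|\<^sup>2 * g \<alpha>\<^sub>0\<close> tends to the integral of \<open>g\<close> over \<open>[0, U]\<close>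
  (\<open>normalized_zeta_product_limit\<close>). The normalizing factor does not depend on \<open>g\<close>, and
  \<open>cos\<^sup>2 t - sin\<^sup>2 t = cos (2 t)\<close> has a positive integral over \<open>[0, U]\<close>, so the asserted quotient
  tends to \<open>1\<close>.

  What has to be known about the ladder is \<open>ln (\<Phi> T) \<sim> ln T\<close> (\<open>ln_ladder_ratio\<close>): it makes the
  logarithms of all reverse iterates comparable to \<open>ln T\<close>. Both halves come from the integral
  equation, with \<open>X = \<Phi> T\<close> and \<open>M T\<close> the integral of \<open>|\<zeta>|\<^sup>2\<close> up to height \<open>T\<close>. The weight
  \<open>exp (- t / X)\<close> takes a mass of order at least \<open>1 / T\<close> away from \<open>[0, T]\<close>, and the integral beyond \<open>T\<close>
  must restore it; were \<open>X\<close> at most \<open>T powr (1 - e)\<close>, that integral would be smaller than \<open>1 / T\<^sup>2\<close>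
  because \<open>\<zeta>\<close> grows polynomially (\<open>ladder_lower_bound\<close>). On the other hand the equation gives
  \<open>M X \<le> 3 * M T\<close>, and integrating \<open>\<Phi>' = |\<zeta>|\<^sup>2 / \<omega>\<close> gives \<open>M T \<le> 3 * X * ln T\<close>; together,
  \<open>M X = O (X ln X)\<close>, and integrating \<open>\<Phi>'\<close> once more bounds \<open>\<Phi>\<close> from above
  (\<open>ladder_upper_bound\<close>).

  The zeta function enters through its continuity and polynomial growth on the critical line.
  As it is defined by choice of an analytic continuation, the existence of one is proved first, by a
  recursion that pushes \<open>(s - 1) \<zeta> s\<close> one unit to the left at each step.\<close>

section \<open>The zeta function near the critical line\<close>

text \<open>The error of the binomial expansion of \<open>(n + 1)\<^sup>a\<close> about \<open>n\<close>, shifted so that \<open>n\<close> starts at \<open>1\<close>.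
  Telescoping \<open>n\<^sup>a - (n + 1)\<^sup>a\<close> with \<open>a = 1 - s\<close> turns these expansions into a linear relation
  between \<open>\<zeta> s, \<zeta> (s + 1), \<dots>\<close>, and the sum of the errors converges in a half-plane that grows with \<open>N\<close>.\<close>
definition zeta_remainder :: "nat \<Rightarrow> complex \<Rightarrow> nat \<Rightarrow> complex" where
  "zeta_remainder N a n = of_nat (Suc (Suc n)) powr a -
     (\<Sum>j\<le>N. (a gchoose j) * of_nat (Suc n) powr (a - of_nat j))"

text \<open>Taylor's formula for \<open>z powr a\<close> on the segment from \<open>n\<close> to \<open>n + 1\<close>: the derivative of order \<open>N + 1\<close>
  has its maximum at the left end because its exponent has nonpositive real part there.\<close>
lemma norm_zeta_remainder_le:
  assumes "Re a \<le> real N + 1"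
  shows "norm (zeta_remainder N a n) \<le>
    (\<Prod>i=0..N. norm (a - of_nat i)) * real (Suc n) powr (Re a - real N - 1)"
proof -
  define f where "f i z = (\<Prod>l=0..<i. a - of_nat l) * z powr (a - of_nat i)" for i and z :: complex
  define w :: complex where "w = of_nat (Suc n)"
  define S where "S = closed_segment w (w + 1)"
  define P where "P = (\<Prod>i=0..N. norm (a - of_nat i))"
  have S: "\<exists>x::real. z = of_real x \<and> real (Suc n) \<le> x" if "z \<in> S" for z
  proof -
    obtain u where u: "0 \<le> u" "u \<le> 1" "z = (1 - u) *\<^sub>R w + u *\<^sub>R (w + 1)"
      using \<open>z \<in> S\<close> unfolding S_def in_segment by blast
    have "z = of_real (real (Suc n) + u)"
      by (simp add: u(3) w_def scaleR_conv_of_real algebra_simps)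
    then show ?thesis using u(1) by (intro exI[of _ "real (Suc n) + u"]) auto
  qed
  have deriv: "(f i has_field_derivative f (Suc i) z) (at z within S)" if "z \<in> S" for i z
  proof -
    from S[OF that] have "z \<notin> \<real>\<^sub>\<le>\<^sub>0" by (auto simp: complex_nonpos_Reals_iff)
    then show ?thesis unfolding f_def
      by (auto intro!: derivative_eq_intros DERIV_cmult
          has_field_derivative_at_within[OF has_field_derivative_powr] simp: algebra_simps)
  qed
  have bound: "norm (f (Suc N) z) \<le> P * real (Suc n) powr (Re a - real N - 1)" if zS: "z \<in> S" for z
  proof -
    obtain x where x: "z = of_real x" "real (Suc n) \<le> x" using S[OF zS] by blast
    have "norm (f (Suc N) z) = P * x powr (Re a - real N - 1)"
      using x by (simp add: f_def P_def norm_mult norm_powr_real_powr prod_norm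
          atLeastLessThanSuc_atLeastAtMost algebra_simps)
    also have "\<dots> \<le> P * real (Suc n) powr (Re a - real N - 1)"
      using x assms by (intro mult_left_mono powr_mono2') (auto simp: P_def intro!: prod_nonneg)
    finally show ?thesis .
  qed
  have "norm (f 0 (w + 1) - (\<Sum>i\<le>N. f i w * ((w + 1) - w) ^ i / fact i))
      \<le> P * real (Suc n) powr (Re a - real N - 1) * norm ((w + 1) - w) ^ Suc N / fact N"
    by (rule complex_Taylor[of S]) (use deriv bound in \<open>auto simp: S_def\<close>)
  also have "\<dots> \<le> P * real (Suc n) powr (Re a - real N - 1)"
  proof -
    have "x / fact N \<le> x" if "x \<ge> 0" for x :: real
      using that by (simp add: pos_divide_le_eq mult_le_cancel_left1 fact_ge_1)
    moreover have "P * real (Suc n) powr (Re a - real N - 1) \<ge> 0"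
      by (auto simp: P_def intro!: mult_nonneg_nonneg prod_nonneg)
    ultimately show ?thesis by simp
  qed
  also have "f 0 (w + 1) - (\<Sum>i\<le>N. f i w * ((w + 1) - w) ^ i / fact i) = zeta_remainder N a n"
    by (simp add: f_def zeta_remainder_def w_def gbinomial_prod_rev field_simps)
  finally show ?thesis by (simp add: P_def)
qed

lemma summable_Suc_powr: "e < -1 \<Longrightarrow> summable (\<lambda>n. real (Suc n) powr e)"
  using summable_Suc_iff[of "\<lambda>n. real n powr e"] by (simp add: summable_real_powr_iff del: of_nat_Suc)

lemma summable_zeta_remainder:
  assumes "Re a < real N"
  shows "summable (zeta_remainder N a)"
proof (rule summable_comparison_test')
  show "summable (\<lambda>n. (\<Prod>i=0..N. norm (a - of_nat i)) * real (Suc n) powr (Re a - real N - 1))"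
    using assms by (intro summable_mult summable_Suc_powr) auto
  show "norm (zeta_remainder N a n) \<le>
      (\<Prod>i=0..N. norm (a - of_nat i)) * real (Suc n) powr (Re a - real N - 1)" for n
    using assms by (intro norm_zeta_remainder_le) auto
qed

text \<open>The bound on the single error is locally uniform in \<open>a\<close>, with an exponent below \<open>-1\<close>; so the series
  converges locally uniformly.\<close>
lemma holomorphic_zeta_remainder_sum:
  "(\<lambda>a. \<Sum>n. zeta_remainder N a n) holomorphic_on {a. Re a < real N}"
proof (rule holomorphic_uniform_sequence)
  show "open {a. Re a < real N}" by (simp add: open_halfspace_Re_lt)
  show "(\<lambda>a. \<Sum>i<n. zeta_remainder N a i) holomorphic_on {a. Re a < real N}" for n
    unfolding zeta_remainder_def gbinomial_prod_rev
    by (auto intro!: holomorphic_intros)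
  fix x assume x: "x \<in> {a. Re a < real N}"
  \<comment> \<open>Half the distance to the boundary keeps the exponent of the majorant below -1.\<close>
  define d where "d = (real N - Re x) / 2"
  have d: "d > 0" using x by (simp add: d_def)
  have Re_le: "Re a \<le> Re x + d" and norm_le: "norm a \<le> norm x + d" if "a \<in> cball x d" for a
  proof -
    have *: "norm (a - x) \<le> d" using that by (simp add: dist_norm norm_minus_commute)
    show "Re a \<le> Re x + d" using * abs_Re_le_cmod[of "a - x"] by simp
    show "norm a \<le> norm x + d" using * norm_triangle_sub[of a x] by simp
  qed
  define B where "B = (\<Prod>i=0..N. norm x + d + real i)"
  have "uniform_limit (cball x d) (\<lambda>n a. \<Sum>i<n. zeta_remainder N a i)
      (\<lambda>a. \<Sum>n. zeta_remainder N a n) sequentially"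
  proof (rule Weierstrass_m_test)
    show "summable (\<lambda>n. B * real (Suc n) powr (Re x + d - real N - 1))"
      using x by (intro summable_mult summable_Suc_powr) (auto simp: d_def field_simps)
    fix n a assume a: "a \<in> cball x d"
    have "Re a \<le> real N" using Re_le[OF a] x by (auto simp: d_def field_simps)
    then have "norm (zeta_remainder N a n) \<le>
        (\<Prod>i=0..N. norm (a - of_nat i)) * real (Suc n) powr (Re a - real N - 1)"
      by (intro norm_zeta_remainder_le) auto
    also have "\<dots> \<le> B * real (Suc n) powr (Re x + d - real N - 1)"
    proof (intro mult_mono)
      show "(\<Prod>i=0..N. norm (a - of_nat i)) \<le> B" unfolding B_def
      proof (intro prod_mono conjI norm_ge_zero)
        fix i show "norm (a - of_nat i) \<le> norm x + d + real i"
          using norm_triangle_ineq4[of a "of_nat i"] norm_le[OF a] by simp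
      qed
      show "real (Suc n) powr (Re a - real N - 1) \<le> real (Suc n) powr (Re x + d - real N - 1)"
        using Re_le[OF a] by (intro powr_mono) auto
    qed (use d in \<open>auto simp: B_def intro!: prod_nonneg\<close>)
    finally show "norm (zeta_remainder N a n) \<le> B * real (Suc n) powr (Re x + d - real N - 1)" .
  qed
  moreover have "cball x d \<subseteq> {a. Re a < real N}"
  proof
    fix a assume "a \<in> cball x d"
    then have "Re a \<le> Re x + d" by (rule Re_le)
    then show "a \<in> {a. Re a < real N}" using x by (simp add: d_def field_simps)
  qed
  ultimately show "\<exists>d>0. cball x d \<subseteq> {a. Re a < real N} \<and>
      uniform_limit (cball x d) (\<lambda>n a. \<Sum>i<n. zeta_remainder N a i)
        (\<lambda>a. \<Sum>n. zeta_remainder N a n) sequentially"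
    using d by blast
qed

definition dirichlet_zeta :: "complex \<Rightarrow> complex" where
  "dirichlet_zeta s = (\<Sum>n. of_nat (Suc n) powr (- s))"

lemma dirichlet_zeta_sums:
  assumes "Re s > 1"
  shows "(\<lambda>n. of_nat (Suc n) powr (- s)) sums dirichlet_zeta s"
proof -
  have "summable (\<lambda>n. (of_nat (Suc n) :: complex) powr (- s))"
  proof (rule summable_comparison_test')
    show "summable (\<lambda>n. real (Suc n) powr (- Re s))"
      using assms by (intro summable_Suc_powr) auto
    show "norm ((of_nat (Suc n) :: complex) powr (- s)) \<le> real (Suc n) powr (- Re s)" for n
      by (simp add: norm_powr_real_powr)
  qed
  then show ?thesis by (simp add: dirichlet_zeta_def summable_sums)
qed

text \<open>The term \<open>j = 1\<close> of the expansion is \<open>(s - 1) \<zeta> s\<close>. In the later terms the binomial coefficient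
  supplies the factor \<open>s + j - 2\<close> that cancels the pole of \<open>\<zeta> (s + j - 1)\<close>, so that only the entire
  function \<open>(s - 1) \<zeta> s\<close> occurs, at arguments further to the right.\<close>
lemma dirichlet_zeta_recursion:
  assumes s: "Re s > 1" and N: "N \<ge> 1"
  shows "(s - 1) * dirichlet_zeta s = 1 + (\<Sum>n. zeta_remainder N (1 - s) n) -
    (\<Sum>j=2..N. ((1 - s) gchoose (j - 1)) / of_nat j *
       ((s + of_nat (j - 1) - 1) * dirichlet_zeta (s + of_nat (j - 1))))"
proof -
  define a where "a = 1 - s"
  define c where "c j = (a gchoose (j - 1)) / of_nat j *
       ((s + of_nat (j - 1) - 1) * dirichlet_zeta (s + of_nat (j - 1)))" for j
  have "(\<lambda>n. (of_nat (Suc n) :: complex) powr a) \<longlonglongrightarrow> 0"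
  proof (rule tendsto_norm_zero_cancel)
    have "(\<lambda>n. real (Suc n) powr Re a) \<longlonglongrightarrow> 0"
      using s by (intro tendsto_neg_powr filterlim_compose[OF filterlim_real_sequentially filterlim_Suc])
        (simp add: a_def)
    then show "(\<lambda>n. norm ((of_nat (Suc n) :: complex) powr a)) \<longlonglongrightarrow> 0"
      by (simp add: norm_powr_real_powr)
  qed
  from telescope_sums'[OF this]
  have tel: "(\<lambda>n. (of_nat (Suc n) :: complex) powr a - of_nat (Suc (Suc n)) powr a) sums 1"
    by simp
  have rem: "zeta_remainder N a sums (\<Sum>n. zeta_remainder N a n)"
    using s N by (intro summable_sums summable_zeta_remainder) (simp add: a_def)
  have single: "(\<lambda>n. (a gchoose j) * (of_nat (Suc n) :: complex) powr (a - of_nat j)) sums (- c j)"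
    if j: "j \<ge> 1" for j
  proof -
    have "(\<lambda>n. (of_nat (Suc n) :: complex) powr (- (s + of_nat (j - 1))))
        sums dirichlet_zeta (s + of_nat (j - 1))"
      using s by (intro dirichlet_zeta_sums) simp
    also have "- (s + of_nat (j - 1)) = a - of_nat j"
      using j by (simp add: a_def of_nat_diff)
    finally have "(\<lambda>n. (a gchoose j) * (of_nat (Suc n) :: complex) powr (a - of_nat j))
        sums ((a gchoose j) * dirichlet_zeta (s + of_nat (j - 1)))"
      by (rule sums_mult)
    moreover have choose: "(a gchoose j) = - ((a gchoose (j - 1)) / of_nat j * (s + of_nat (j - 1) - 1))"
    proof -
      have "(a - of_nat (j - 1)) * (a gchoose (j - 1)) = of_nat j * (a gchoose j)"
        using gbinomial_mult_1[of a "j - 1"] j by (simp add: algebra_simps del: of_nat_Suc)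
      then show ?thesis using j by (simp add: a_def field_simps)
    qed
    moreover have "- c j = (a gchoose j) * dirichlet_zeta (s + of_nat (j - 1))"
      unfolding c_def choose by simp
    ultimately show ?thesis by simp
  qed
  have "(\<lambda>n. - (\<Sum>j=1..N. (a gchoose j) * (of_nat (Suc n) :: complex) powr (a - of_nat j))
         - zeta_remainder N a n) sums (- (\<Sum>j=1..N. - c j) - (\<Sum>n. zeta_remainder N a n))"
    by (intro sums_diff sums_minus sums_sum single rem) auto
  also have "(\<lambda>n. - (\<Sum>j=1..N. (a gchoose j) * (of_nat (Suc n) :: complex) powr (a - of_nat j))
         - zeta_remainder N a n) = (\<lambda>n. of_nat (Suc n) powr a - of_nat (Suc (Suc n)) powr a)"
    by (rule ext) (simp add: zeta_remainder_def atMost_atLeast0 sum.atLeast_Suc_atMost)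
  finally have "1 = (\<Sum>j=1..N. c j) - (\<Sum>n. zeta_remainder N a n)"
    using tel sums_unique2 by (fastforce simp: sum_negf)
  moreover have "(\<Sum>j=1..N. c j) = c 1 + (\<Sum>j=2..N. c j)"
    using N by (simp add: sum.atLeast_Suc_atMost numeral_2_eq_2)
  moreover have "c 1 = (s - 1) * dirichlet_zeta s" by (simp add: c_def)
  ultimately show ?thesis unfolding c_def a_def by (simp add: algebra_simps)
qed

text \<open>With \<open>N\<close> large enough, the right-hand side of the recursion is defined one unit further to the left than
  the continuation that it contains. For \<open>N = 1\<close> it contains no value of \<open>\<zeta>\<close>, which starts the induction on the half-plane \<open>Re s > 0\<close>.\<close>
lemma zeta_continuation_strip:
  "\<exists>g. g holomorphic_on {s. Re s > - real m} \<and>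
       (\<forall>s. Re s > 1 \<longrightarrow> g s = (s - 1) * dirichlet_zeta s)"
proof (induction m)
  case 0
  show ?case
  proof (intro exI conjI allI impI)
    show "(\<lambda>s. 1 + (\<Sum>n. zeta_remainder 1 (1 - s) n)) holomorphic_on {s. Re s > - real 0}"
      by (intro holomorphic_intros holomorphic_on_compose_gen
          [OF _ holomorphic_zeta_remainder_sum[of 1], unfolded o_def]) auto
    show "1 + (\<Sum>n. zeta_remainder 1 (1 - s) n) = (s - 1) * dirichlet_zeta s" if "Re s > 1" for s
      using dirichlet_zeta_recursion[OF that, of 1] by simp
  qed
next
  case (Suc m)
  then obtain g where g: "g holomorphic_on {s. Re s > - real m}"
    "\<And>s. Re s > 1 \<Longrightarrow> g s = (s - 1) * dirichlet_zeta s" by blast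
  define N where "N = m + 2"
  show ?case
  proof (intro exI conjI allI impI)
    show "(\<lambda>s. 1 + (\<Sum>n. zeta_remainder N (1 - s) n) -
        (\<Sum>j=2..N. ((1 - s) gchoose (j - 1)) / of_nat j * g (s + of_nat (j - 1))))
        holomorphic_on {s. Re s > - real (Suc m)}"
      unfolding gbinomial_prod_rev
      by (intro holomorphic_intros holomorphic_on_compose_gen
          [OF _ holomorphic_zeta_remainder_sum[of N], unfolded o_def]
          holomorphic_on_compose_gen[OF _ g(1), unfolded o_def])
        (auto simp: N_def of_nat_diff)
    show "1 + (\<Sum>n. zeta_remainder N (1 - s) n) -
        (\<Sum>j=2..N. ((1 - s) gchoose (j - 1)) / of_nat j * g (s + of_nat (j - 1)))
        = (s - 1) * dirichlet_zeta s" if "Re s > 1" for s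
    proof -
      have "g (s + of_nat (j - 1)) = (s + of_nat (j - 1) - 1) * dirichlet_zeta (s + of_nat (j - 1))" for j
        using that by (intro g(2)) auto
      moreover have "N \<ge> 1" by (simp add: N_def)
      ultimately show ?thesis by (simp only: dirichlet_zeta_recursion[OF that])
    qed
  qed
qed

text \<open>Any two of the half-plane continuations agree with the Dirichlet series, hence with each other,
  and can be glued.\<close>
lemma zeta_continuation_exists:
  "\<exists>g. g holomorphic_on UNIV \<and> (\<forall>s. Re s > 1 \<longrightarrow> g s = (s - 1) * dirichlet_zeta s)"
proof -
  obtain G where G: "\<And>m. G m holomorphic_on {s. Re s > - real m}"
    "\<And>m s. Re s > 1 \<Longrightarrow> G m s = (s - 1) * dirichlet_zeta s"
    using zeta_continuation_strip by metis
  have agree: "G m s = G n s" if that: "m \<le> n" "Re s > - real m" for m n s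
  proof (rule analytic_continuation_open[of "{s. Re s > 1}" "{s. Re s > - real m}" "G m" "G n"])
    show "{s. 1 < Re s} \<noteq> {}" by (auto intro!: exI[of _ 2])
    show "connected {s. - real m < Re s}"
      by (intro convex_connected convex_halfspace_Re_gt)
    show "G n holomorphic_on {s. - real m < Re s}"
      using that by (intro holomorphic_on_subset[OF G(1)[of n]]) auto
  qed (use G that in \<open>auto simp: open_halfspace_Re_gt\<close>)
  \<comment> \<open>Any index whose half-plane contains the point would do; this one is explicit.\<close>
  define g where "g s = G (nat \<lceil>norm s\<rceil> + 1) s" for s
  have g_eq: "g s = G m s" if "Re s > - real m" for m s
  proof -
    have "- norm s \<le> Re s" using abs_Re_le_cmod[of s] by linarith
    then have "Re s > - real (nat \<lceil>norm s\<rceil> + 1)" by linarith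
    with that show ?thesis
      unfolding g_def by (metis agree le_cases)
  qed
  have "g holomorphic_on UNIV"
  proof (rule holomorphic_onI)
    fix s
    obtain m where m: "- Re s < real m" using reals_Archimedean2 by blast
    have "g holomorphic_on {s. Re s > - real m}"
      using G(1)[of m] by (rule holomorphic_transform) (auto simp: g_eq)
    then show "g field_differentiable (at s within UNIV)"
      using m by (auto simp: holomorphic_on_open open_halfspace_Re_gt field_differentiable_def)
  qed
  moreover have "g s = (s - 1) * dirichlet_zeta s" if "Re s > 1" for s
    using g_eq[of 0 s] G(2) that by simp
  ultimately show ?thesis by blast
qed

text \<open>The choice in the definition of \<open>riemann_zeta\<close> is justified by the continuation just constructed.\<close>
lemma riemann_zeta_continuation:
  "riemann_zeta holomorphic_on - {1}"
  "Re s > 1 \<Longrightarrow> riemann_zeta s = dirichlet_zeta s"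
proof -
  obtain g where g: "g holomorphic_on UNIV" "\<And>s. Re s > 1 \<Longrightarrow> g s = (s - 1) * dirichlet_zeta s"
    using zeta_continuation_exists by blast
  have "(\<lambda>s. g s / (s - 1)) holomorphic_on - {1}"
    by (intro holomorphic_intros holomorphic_on_subset[OF g(1)]) auto
  moreover have "(\<lambda>n. of_nat (Suc n) powr (- s)) sums (g s / (s - 1))" if "Re s > 1" for s
    using dirichlet_zeta_sums[OF that] g(2)[OF that] that by (cases "s = 1") auto
  ultimately have "\<exists>f. f holomorphic_on - {1} \<and>
     (\<forall>s. Re s > 1 \<longrightarrow> (\<lambda>n. of_nat (Suc n) powr (- s)) sums f s)"
    by (intro exI[of _ "\<lambda>s. g s / (s - 1)"] conjI allI impI)
  from someI_ex[OF this] have "riemann_zeta holomorphic_on - {1}"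
    and sums: "\<forall>s. Re s > 1 \<longrightarrow> (\<lambda>n. of_nat (Suc n) powr (- s)) sums riemann_zeta s"
    unfolding riemann_zeta_def by auto
  then show "riemann_zeta holomorphic_on - {1}" by simp
  show "riemann_zeta s = dirichlet_zeta s" if "Re s > 1"
    using sums_unique2[of "\<lambda>n. of_nat (Suc n) powr (- s)"] sums dirichlet_zeta_sums[OF that] that by simp
qed

text \<open>The recursion with \<open>N = 1\<close> persists to the critical strip by the identity theorem, and is the source of
  the growth bound on the critical line.\<close>
lemma riemann_zeta_right_half_plane:
  assumes "Re s > 0" "s \<noteq> 1"
  shows "(s - 1) * riemann_zeta s = 1 + (\<Sum>n. zeta_remainder 1 (1 - s) n)"
proof (rule analytic_continuation_open[of "{s. Re s > 1}" "{s. Re s > 0} - {1}"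
      "\<lambda>s. (s - 1) * riemann_zeta s"])
  show "{s. 1 < Re s} \<noteq> {}" by (auto intro!: exI[of _ 2])
  show "connected ({s. 0 < Re s} - {1})"
    by (intro connected_open_delete open_halfspace_Re_gt convex_connected convex_halfspace_Re_gt) auto
  show "(\<lambda>s. 1 + (\<Sum>n. zeta_remainder 1 (1 - s) n)) holomorphic_on {s. 0 < Re s} - {1}"
    by (intro holomorphic_intros holomorphic_on_compose_gen
        [OF _ holomorphic_zeta_remainder_sum[of 1], unfolded o_def]) auto
  show "(\<lambda>s. (s - 1) * riemann_zeta s) holomorphic_on {s. 0 < Re s} - {1}"
    by (intro holomorphic_intros holomorphic_on_subset[OF riemann_zeta_continuation(1)]) auto
  show "(s - 1) * riemann_zeta s = 1 + (\<Sum>n. zeta_remainder 1 (1 - s) n)" if "s \<in> {s. 1 < Re s}" for s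
    using that dirichlet_zeta_recursion[of s 1] by (simp add: riemann_zeta_continuation)
qed (use assms in \<open>auto simp: open_halfspace_Re_gt open_delete\<close>)

lemma continuous_zeta_sq: "continuous_on A zeta_sq"
proof -
  have "continuous_on (- {1}) riemann_zeta"
    by (intro holomorphic_on_imp_continuous_on riemann_zeta_continuation)
  then have "continuous_on A (\<lambda>t. riemann_zeta (1/2 + \<i> * of_real t))"
    by (rule continuous_on_compose2) (auto intro!: continuous_intros simp: complex_eq_iff)
  then show ?thesis unfolding zeta_sq_def by (intro continuous_intros)
qed

lemma zeta_sq_nonneg [simp]: "zeta_sq t \<ge> 0"
  by (simp add: zeta_sq_def)

text \<open>On the critical line the errors sum to at most a constant times \<open>|s|\<^sup>2\<close>, and division by \<open>|s - 1| = |s|\<close>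
  leaves a linear bound for \<open>|\<zeta>|\<close>.\<close>
lemma zeta_sq_le: "\<exists>C>0. \<forall>t\<ge>0. zeta_sq t \<le> C * (1 + t)\<^sup>2"
proof -
  define K where "K = (\<Sum>n. real (Suc n) powr (- 3 / 2))"
  have K_summable: "summable (\<lambda>n. real (Suc n) powr (- 3 / 2))"
    by (rule summable_Suc_powr) simp
  have "K \<ge> 0" unfolding K_def by (intro suminf_nonneg K_summable) simp
  have "zeta_sq t \<le> (2 + K)\<^sup>2 * (1 + t)\<^sup>2" if t: "t \<ge> 0" for t
  proof -
    define s where "s = 1/2 + \<i> * of_real t"
    have s_norm: "norm s \<le> 1 + t"
      using cmod_le[of s] t by (simp add: s_def)
    have refl: "norm (1 - s) = norm s"
      by (simp add: s_def cmod_def)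
    have half: "norm s \<ge> 1/2"
      using abs_Re_le_cmod[of s] by (simp add: s_def)
    have bound: "norm (zeta_remainder 1 (1 - s) n) \<le> (norm s)\<^sup>2 * real (Suc n) powr (- 3 / 2)" for n
    proof -
      have "(\<Prod>i=0..1. norm (1 - s - of_nat i)) = (norm s)\<^sup>2"
        using refl by (simp add: power2_eq_square atLeast0_atMost_Suc)
      moreover have "Re (1 - s) - real 1 - 1 = - 3 / 2" by (simp add: s_def)
      ultimately show ?thesis using norm_zeta_remainder_le[of "1 - s" 1 n]
        by (simp only: s_def)
    qed
    have summ: "summable (\<lambda>n. (norm s)\<^sup>2 * real (Suc n) powr (- 3 / 2))"
      by (intro summable_mult K_summable)
    have "norm (\<Sum>n. zeta_remainder 1 (1 - s) n) \<le> (\<Sum>n. (norm s)\<^sup>2 * real (Suc n) powr (- 3 / 2))"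
      by (intro norm_suminf_le bound summ)
    also have "\<dots> = (norm s)\<^sup>2 * K" unfolding K_def by (rule suminf_mult[OF K_summable])
    finally have "norm (1 + (\<Sum>n. zeta_remainder 1 (1 - s) n)) \<le> 1 + (norm s)\<^sup>2 * K"
      using norm_triangle_ineq[of 1 "\<Sum>n. zeta_remainder 1 (1 - s) n"] by simp
    moreover have "(s - 1) * riemann_zeta s = 1 + (\<Sum>n. zeta_remainder 1 (1 - s) n)"
      by (rule riemann_zeta_right_half_plane) (auto simp: s_def complex_eq_iff)
    ultimately have "norm s * norm (riemann_zeta s) \<le> 1 + (norm s)\<^sup>2 * K"
      by (metis norm_minus_commute norm_mult refl)
    also have "\<dots> \<le> norm s * 2 + norm s * (norm s * K)"
      using half by (simp add: power2_eq_square)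
    finally have "norm s * norm (riemann_zeta s) \<le> norm s * (2 + norm s * K)"
      by (simp add: algebra_simps)
    then have "norm (riemann_zeta s) \<le> 2 + norm s * K"
      using half by (subst (asm) mult_le_cancel_left_pos) auto
    also have "\<dots> \<le> 2 * (1 + t) + (1 + t) * K"
      using s_norm t \<open>K \<ge> 0\<close> by (intro add_mono mult_right_mono) auto
    finally have "norm (riemann_zeta s) \<le> (2 + K) * (1 + t)" by (simp add: algebra_simps)
    then have "(norm (riemann_zeta s))\<^sup>2 \<le> ((2 + K) * (1 + t))\<^sup>2"
      by (intro power_mono) auto
    then show ?thesis by (simp add: zeta_sq_def s_def power_mult_distrib)
  qed
  then show ?thesis using \<open>K \<ge> 0\<close> by (intro exI[of _ "(2 + K)\<^sup>2"]) auto
qed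

section \<open>Growth of the ladder\<close>

text \<open>The hypotheses that concern the ladder alone, without the window \<open>U\<close> and the number \<open>k\<close> of iterations.\<close>
locale zeta_ladder =
  fixes \<mu> \<phi> \<omega> :: "real \<Rightarrow> real" and y0 t0 :: real
  assumes weight: "ladder_weight y0 \<mu>"
    and ladder: "solves_ladder_equation y0 \<mu> \<phi>"
    and increasing: "strict_mono_on {t0..} (jacobs_ladder \<phi>)"
    and derivative: "\<forall>\<^sub>F t in at_top.
          (jacobs_ladder \<phi> has_real_derivative zeta_sq t / \<omega> t) (at t)"
    and omega: "(\<lambda>t. \<omega> t / ln t - 1) \<in> O[at_top](\<lambda>t. ln (ln t) / ln t)"
begin

abbreviation \<Phi> :: "real \<Rightarrow> real" where "\<Phi> \<equiv> jacobs_ladder \<phi>"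

definition second_moment :: "real \<Rightarrow> real" where "second_moment T = integral {0..T} zeta_sq"

lemma \<phi>_eq: "\<phi> t = 2 * \<Phi> t" by (simp add: jacobs_ladder_def)

lemma integrable_zeta_sq: "zeta_sq integrable_on {a..b}"
  by (intro integrable_continuous_real continuous_zeta_sq)

lemma second_moment_derivative:
  assumes "t > 0" shows "(second_moment has_real_derivative zeta_sq t) (at t)"
proof -
  have "((\<lambda>u. integral {0..u} zeta_sq) has_real_derivative zeta_sq t) (at t within {0..t + 1})"
    by (rule integral_has_real_derivative) (use assms in \<open>auto intro: continuous_zeta_sq\<close>)
  moreover have "at t within {0..t + 1} = at t"
    by (rule at_within_interior) (use assms in auto)
  ultimately show ?thesis by (simp add: second_moment_def[abs_def])
qed

lemma omega_ratio: "((\<lambda>t. \<omega> t / ln t) \<longlongrightarrow> 1) at_top"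
proof -
  have "(\<lambda>t::real. ln (ln t) / ln t) \<in> o[at_top](\<lambda>_. 1)" by real_asymp
  with omega have "(\<lambda>t. \<omega> t / ln t - 1) \<in> o[at_top](\<lambda>_. 1)"
    by (rule landau_o.big_small_trans)
  then have "((\<lambda>t. \<omega> t / ln t - 1) \<longlongrightarrow> 0) at_top"
    by (auto dest: smalloD_tendsto)
  then show ?thesis by (simp add: LIM_zero_iff)
qed

text \<open>One ray on which all the eventual properties of the ladder hold, so that the mean value
  theorem can be applied on intervals inside it.\<close>
lemma regular_ray:
  "\<exists>t1\<ge>max t0 3. \<forall>t\<ge>t1. (\<Phi> has_real_derivative zeta_sq t / \<omega> t) (at t) \<and>
     ln t / 2 \<le> \<omega> t \<and> \<omega> t \<le> 2 * ln t \<and> \<Phi> t > 0"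
proof -
  have 1: "\<forall>\<^sub>F t in at_top. \<omega> t / ln t > 1/2" "\<forall>\<^sub>F t in at_top. \<omega> t / ln t < 2"
    using order_tendstoD(1)[OF omega_ratio, of "1/2"] order_tendstoD(2)[OF omega_ratio, of 2] by simp_all
  have 2: "\<forall>\<^sub>F t::real in at_top. t \<ge> max t0 3" by (rule eventually_ge_at_top)
  have 3: "\<forall>\<^sub>F t in at_top. \<phi> t > y0"
    using ladder unfolding solves_ladder_equation_def by eventually_elim auto
  have "\<forall>\<^sub>F t in at_top. t \<ge> max t0 3 \<and> (\<Phi> has_real_derivative zeta_sq t / \<omega> t) (at t) \<and>
     ln t / 2 \<le> \<omega> t \<and> \<omega> t \<le> 2 * ln t \<and> \<Phi> t > 0"
    using 1 2 3 derivative
  proof eventually_elim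
    case (elim t)
    then have "ln t > 0" by simp
    moreover have "\<Phi> t > 0"
      using elim weight by (simp add: jacobs_ladder_def ladder_weight_def)
    ultimately show ?case using elim by (simp add: field_simps)
  qed
  then obtain t1 where t1: "\<forall>t\<ge>t1. t \<ge> max t0 3 \<and> (\<Phi> has_real_derivative zeta_sq t / \<omega> t) (at t) \<and>
     ln t / 2 \<le> \<omega> t \<and> \<omega> t \<le> 2 * ln t \<and> \<Phi> t > 0"
    by (auto simp: eventually_at_top_linorder)
  show ?thesis
  proof (intro exI[of _ t1] conjI)
    show "t1 \<ge> max t0 3" using t1 by blast
  qed (use t1 in blast)
qed

text \<open>A ladder that is strictly increasing cannot have a derivative that vanishes on a ray, so \<open>|\<zeta>|\<^sup>2\<close> has
  positive mass. The mass is measured beyond \<open>1\<close>, where the weight \<open>exp (- t / X)\<close> removes at least the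
  proportion \<open>1 - exp (- 1 / X)\<close> of it.\<close>
lemma positive_mass: "\<exists>m0>0. \<forall>\<^sub>F T in at_top. integral {1..T} zeta_sq \<ge> m0"
proof -
  obtain t1 where t1: "t1 \<ge> t0" "t1 \<ge> 3"
    "\<And>t. t \<ge> t1 \<Longrightarrow> (\<Phi> has_real_derivative zeta_sq t / \<omega> t) (at t)"
    using regular_ray by auto
  have "\<exists>t\<ge>t1. zeta_sq t \<noteq> 0"
  proof (rule ccontr)
    assume "\<not> ?thesis"
    then have const: "(\<Phi> has_real_derivative 0) (at t)" if "t \<ge> t1" for t
      using t1(3)[OF that] that by auto
    have "\<Phi> (t1 + 1) = \<Phi> t1"
    proof (rule DERIV_isconst_end[of t1 "t1 + 1" \<Phi>])
      show "continuous_on {t1..t1 + 1} \<Phi>"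
        using DERIV_isCont[OF const] by (intro continuous_at_imp_continuous_on) auto
    qed (use const in auto)
    moreover have "\<Phi> t1 < \<Phi> (t1 + 1)"
      using t1 by (intro strict_mono_onD[OF increasing]) auto
    ultimately show False by simp
  qed
  then obtain t where t: "t \<ge> t1" "zeta_sq t \<noteq> 0" by blast
  have "integral {1..t} zeta_sq \<noteq> 0"
    using integral_eq_0_iff[of 1 t zeta_sq] t t1 by (auto simp: continuous_zeta_sq)
  moreover have "integral {1..t} zeta_sq \<ge> 0"
    by (intro integral_nonneg integrable_zeta_sq) auto
  ultimately have "integral {1..t} zeta_sq > 0" by simp
  moreover have "\<forall>\<^sub>F T in at_top. integral {1..T} zeta_sq \<ge> integral {1..t} zeta_sq"
    using eventually_ge_at_top[of t]
    by eventually_elim (intro integral_subset_le integrable_zeta_sq; auto)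
  ultimately show ?thesis by blast
qed

text \<open>The equation says that the mass that the weight \<open>exp (- t / X)\<close>, \<open>X = \<Phi> T\<close>, removes from \<open>[0, T]\<close> equals the
  weighted mass beyond \<open>T\<close>. The former is at least \<open>m0 * (1 - exp (- 1 / T))\<close> as soon as \<open>X \<le> T\<close>. If even
  \<open>X \<le> T powr (1 - e)\<close>, the weight beyond \<open>T\<close> is at most \<open>exp (- (t powr e))\<close>, which beats the
  polynomial growth of \<open>|\<zeta>|\<^sup>2\<close>.\<close>
lemma ladder_lower_bound:
  assumes e: "0 < e" "e < 1"
  shows "\<forall>\<^sub>F T in at_top. T powr (1 - e) < \<Phi> T"
proof -
  obtain m0 where m0: "m0 > 0" "\<forall>\<^sub>F T in at_top. integral {1..T} zeta_sq \<ge> m0"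
    using positive_mass by blast
  obtain C where C: "C > 0" "\<And>t. t \<ge> 0 \<Longrightarrow> zeta_sq t \<le> C * (1 + t)\<^sup>2"
    using zeta_sq_le by blast
  have "\<forall>\<^sub>F t::real in at_top. C * (1 + t)\<^sup>2 * exp (- (t powr e)) \<le> 1 / t ^ 3"
    using e C(1) by real_asymp
  then have tail: "\<forall>\<^sub>F T::real in at_top. \<forall>t\<ge>T. C * (1 + t)\<^sup>2 * exp (- (t powr e)) \<le> 1 / t ^ 3"
    by (rule eventually_all_ge_at_top)
  have gap: "\<forall>\<^sub>F T::real in at_top. 1 / (2 * T\<^sup>2) < m0 * (1 - exp (- (1 / T)))"
    using m0(1) by real_asymp
  show ?thesis
    using ladder[unfolded solves_ladder_equation_def] m0(2) tail gap eventually_ge_at_top[of 1]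
  proof eventually_elim
    case (elim T)
    show ?case
    proof (rule ccontr)
      define X where "X = \<Phi> T"
      define E where "E t = exp (- (t / X))" for t :: real
      define W where "W = \<mu> (\<phi> T)"
      have X: "X > 0"
        using elim weight by (simp add: X_def jacobs_ladder_def ladder_weight_def)
      assume "\<not> T powr (1 - e) < \<Phi> T"
      then have X_le: "X \<le> T powr (1 - e)" by (simp add: X_def)
      have cont: "continuous_on A E" for A unfolding E_def using X by (intro continuous_intros) auto
      have int: "(\<lambda>t. zeta_sq t * E t) integrable_on {a..b}" for a b
        by (intro integrable_continuous_real continuous_intros continuous_zeta_sq cont)
      have int': "(\<lambda>t. zeta_sq t * (1 - E t)) integrable_on {a..b}" for a b
        by (intro integrable_continuous_real continuous_intros continuous_zeta_sq cont)
      have eqn: "integral {0..W} (\<lambda>t. zeta_sq t * E t) = integral {0..T} zeta_sq"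
        using elim(1) by (simp add: W_def E_def X_def \<phi>_eq)
      \<comment> \<open>The mass removed from [0, T] in terms of the two sides of the equation.\<close>
      have "integral {0..T} (\<lambda>t. zeta_sq t * (1 - E t)) =
          integral {0..T} (\<lambda>t. zeta_sq t - zeta_sq t * E t)"
        by (simp add: algebra_simps)
      also have "\<dots> = integral {0..T} zeta_sq - integral {0..T} (\<lambda>t. zeta_sq t * E t)"
        by (intro integral_diff integrable_zeta_sq int)
      finally have loss_eq: "integral {0..T} (\<lambda>t. zeta_sq t * (1 - E t)) =
          integral {0..W} (\<lambda>t. zeta_sq t * E t) - integral {0..T} (\<lambda>t. zeta_sq t * E t)"
        by (simp add: eqn)
      have "T powr (1 - e) \<le> T powr 1" using elim e by (intro powr_mono) auto
      then have "X \<le> T" using X_le elim by simp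
      then have E1: "E t \<le> exp (- (1 / T))" if "t \<ge> 1" for t
        using that X elim unfolding E_def by (auto intro!: frac_le)
      have E_le1: "E t \<le> 1" if "t \<ge> 0" for t using that X by (simp add: E_def)
      have "m0 * (1 - exp (- (1 / T))) \<le> integral {1..T} zeta_sq * (1 - exp (- (1 / T)))"
        using elim by (intro mult_right_mono) auto
      also have "\<dots> = integral {1..T} (\<lambda>t. zeta_sq t * (1 - exp (- (1 / T))))"
        by simp
      also have "\<dots> \<le> integral {1..T} (\<lambda>t. zeta_sq t * (1 - E t))"
        using E1 by (intro integral_le int' integrable_on_mult_left integrable_zeta_sq mult_left_mono) auto
      also have "\<dots> \<le> integral {0..T} (\<lambda>t. zeta_sq t * (1 - E t))"
        using E_le1 by (intro integral_subset_le int') auto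
      finally have loss: "1 / (2 * T\<^sup>2) < integral {0..T} (\<lambda>t. zeta_sq t * (1 - E t))"
        using elim by simp
      show False
      \<comment> \<open>If the integral in the equation stops before T, nothing at all restores the removed mass.\<close>
      proof (cases "W \<le> T")
        case True
        have "integral {0..W} (\<lambda>t. zeta_sq t * E t) \<le> integral {0..T} (\<lambda>t. zeta_sq t * E t)"
          using True by (intro integral_subset_le int) (auto simp: E_def)
        moreover have "1 / (2 * T\<^sup>2) \<ge> 0" by simp
        ultimately show False using loss loss_eq by linarith
      next
        case False
        have "integral {0..T} (\<lambda>t. zeta_sq t * E t) + integral {T..W} (\<lambda>t. zeta_sq t * E t)
            = integral {0..W} (\<lambda>t. zeta_sq t * E t)"
          using False elim by (intro Henstock_Kurzweil_Integration.integral_combine int) auto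
        then have gain_eq: "integral {0..T} (\<lambda>t. zeta_sq t * (1 - E t)) =
            integral {T..W} (\<lambda>t. zeta_sq t * E t)"
          using loss_eq by simp
        have prim: "((\<lambda>t. 1 / t ^ 3) has_integral (- 1 / (2 * W\<^sup>2) - (- 1 / (2 * T\<^sup>2)))) {T..W}"
          using False elim
          by (intro fundamental_theorem_of_calculus)
            (auto intro!: derivative_eq_intros simp: has_real_derivative_iff_has_vector_derivative[symmetric]
              field_simps power2_eq_square power3_eq_cube)
        have "integral {T..W} (\<lambda>t. zeta_sq t * E t) \<le> integral {T..W} (\<lambda>t. 1 / t ^ 3)"
        proof (intro integral_le int has_integral_integrable[OF prim])
          fix t assume t: "t \<in> {T..W}"
          then have t1: "t \<ge> 1" "t \<ge> T" using elim by auto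
          have "t powr e * X \<le> t powr e * t powr (1 - e)"
            using X_le t1 e elim
            by (intro mult_left_mono order_trans[OF X_le] powr_mono2) auto
          also have "\<dots> = t" using t1 by (simp flip: powr_add)
          finally have "t powr e \<le> t / X" using X by (simp add: field_simps)
          then have "zeta_sq t * E t \<le> (C * (1 + t)\<^sup>2) * exp (- (t powr e))"
            using C(2)[of t] C(1) t1 unfolding E_def by (intro mult_mono) auto
          also have "\<dots> \<le> 1 / t ^ 3" using elim t1 by auto
          finally show "zeta_sq t * E t \<le> 1 / t ^ 3" .
        qed
        also have "\<dots> = - 1 / (2 * W\<^sup>2) - (- 1 / (2 * T\<^sup>2))" by (rule integral_unique[OF prim])
        also have "\<dots> \<le> 1 / (2 * T\<^sup>2)" by simp
        finally show False using loss gain_eq by simp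
      qed
    qed
  qed
qed

lemma ladder_at_top: "filterlim \<Phi> at_top at_top"
proof (rule filterlim_at_top_mono)
  show "filterlim (\<lambda>T::real. T powr (1 - 1/2)) at_top at_top" by real_asymp
  show "\<forall>\<^sub>F T in at_top. T powr (1 - 1/2) \<le> \<Phi> T"
    using ladder_lower_bound[of "1/2"] by (auto elim: eventually_mono)
qed

abbreviation \<Psi> :: "real \<Rightarrow> real" where "\<Psi> \<equiv> inv_into {t0..} \<Phi>"

text \<open>Being continuous and unbounded on a ray, the ladder attains every large value, and injectivity on
  \<open>{t0..}\<close> makes \<open>inv_into\<close> pick a large preimage.\<close>
lemma inverse_beyond: "\<forall>\<^sub>F x in at_top. \<Psi> x \<ge> a \<and> \<Phi> (\<Psi> x) = x"
proof -
  obtain t1 where t1: "t1 \<ge> t0" "t1 \<ge> 3"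
    "\<And>t. t \<ge> t1 \<Longrightarrow> (\<Phi> has_real_derivative zeta_sq t / \<omega> t) (at t)"
    using regular_ray by auto
  define c where "c = max a t1"
  show ?thesis
    using eventually_ge_at_top[of "\<Phi> c"]
  proof eventually_elim
    case (elim x)
    have "\<forall>\<^sub>F t in at_top. \<Phi> t \<ge> x"
      using ladder_at_top by (simp add: filterlim_at_top)
    then have "\<forall>\<^sub>F t in at_top. \<Phi> t \<ge> x \<and> t \<ge> c"
      using eventually_ge_at_top[of c] by eventually_elim auto
    then obtain t2 where "\<Phi> t2 \<ge> x" "t2 \<ge> c"
      by (auto dest: eventually_happens)
    moreover have "isCont \<Phi> t" if "t \<ge> c" for t
      using t1(3)[of t] that by (auto simp: c_def intro: DERIV_isCont)
    ultimately obtain t where "t \<ge> c" "\<Phi> t = x"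
      using IVT[of \<Phi> c x t2] elim by auto
    then have x: "x \<in> \<Phi> ` {t0..}" using t1(1) by (auto simp: c_def)
    have inv: "\<Psi> x \<ge> t0" "\<Phi> (\<Psi> x) = x"
      using inv_into_into[OF x] f_inv_into_f[OF x] by auto
    have "\<Psi> x \<ge> c"
    proof (rule ccontr)
      assume "\<not> \<Psi> x \<ge> c"
      then have "\<Phi> (\<Psi> x) < \<Phi> c"
        using inv t1(1) by (intro strict_mono_onD[OF increasing]) (auto simp: c_def)
      then show False using inv elim by simp
    qed
    then show ?case using inv by (simp add: c_def)
  qed
qed

lemma inverse_at_top: "filterlim \<Psi> at_top at_top"
  unfolding filterlim_at_top by (auto intro: eventually_mono[OF inverse_beyond])

text \<open>On \<open>[0, X]\<close> the weight is at least \<open>exp (- 1)\<close>, and the growth of \<open>\<mu>\<close> puts \<open>[0, X]\<close> inside the range of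
  integration.\<close>
lemma second_moment_ladder_le: "\<forall>\<^sub>F T in at_top. second_moment (\<Phi> T) \<le> 3 * second_moment T"
proof -
  have weight_large: "\<forall>\<^sub>F X::real in at_top. X \<le> 7 * (2 * X) * ln (2 * X)" by real_asymp
  then have "\<forall>\<^sub>F T in at_top. \<Phi> T \<le> 7 * (2 * \<Phi> T) * ln (2 * \<Phi> T)"
    using ladder_at_top by (rule eventually_compose_filterlim)
  then show ?thesis using ladder[unfolded solves_ladder_equation_def]
  proof eventually_elim
    case (elim T)
    define X where "X = \<Phi> T"
    have X: "X > 0"
      using elim weight by (simp add: X_def jacobs_ladder_def ladder_weight_def)
    have "7 * \<phi> T * ln (\<phi> T) \<le> \<mu> (\<phi> T)"
      using elim weight by (simp add: ladder_weight_def)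
    then have "X \<le> \<mu> (\<phi> T)" using elim by (simp add: X_def \<phi>_eq)
    have int: "(\<lambda>t. zeta_sq t * exp (- (t / X))) integrable_on {a..b}" for a b
      using X by (intro integrable_continuous_real continuous_intros continuous_zeta_sq) auto
    have "second_moment X * exp (- 1) = integral {0..X} (\<lambda>t. zeta_sq t * exp (- 1))"
      by (simp add: second_moment_def)
    also have "\<dots> \<le> integral {0..X} (\<lambda>t. zeta_sq t * exp (- (t / X)))"
      using X by (intro integral_le int integrable_on_mult_left integrable_zeta_sq mult_left_mono) auto
    also have "\<dots> \<le> integral {0..\<mu> (\<phi> T)} (\<lambda>t. zeta_sq t * exp (- (t / X)))"
      using \<open>X \<le> \<mu> (\<phi> T)\<close> by (intro integral_subset_le int) auto
    also have "\<dots> = second_moment T"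
      using elim by (simp add: second_moment_def X_def \<phi>_eq)
    finally have "second_moment X \<le> exp 1 * second_moment T" by (simp add: exp_minus field_simps)
    also have "\<dots> \<le> 3 * second_moment T"
      using exp_le by (intro mult_right_mono) (auto simp: second_moment_def intro!: integral_nonneg integrable_zeta_sq)
    finally show ?case by (simp add: X_def)
  qed
qed

text \<open>Up to height \<open>T\<close> the ladder grows at least at the rate \<open>|\<zeta>|\<^sup>2 / (2 ln T)\<close>. The contribution of the
  initial segment is absorbed by the third \<open>ln T * \<Phi> T\<close>.\<close>
lemma second_moment_le_ladder: "\<forall>\<^sub>F T in at_top. second_moment T \<le> 3 * ln T * \<Phi> T"
proof -
  obtain t1 where t1: "t1 \<ge> 3"
    "\<And>t. t \<ge> t1 \<Longrightarrow> (\<Phi> has_real_derivative zeta_sq t / \<omega> t) (at t)"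
    "\<And>t. t \<ge> t1 \<Longrightarrow> \<omega> t \<le> 2 * ln t" "\<And>t. t \<ge> t1 \<Longrightarrow> ln t / 2 \<le> \<omega> t" "\<Phi> t1 > 0"
    using regular_ray by auto
  \<comment> \<open>The unsimplified exponent matches the instance e = 1/2 of the lower bound for the ladder.\<close>
  have "\<forall>\<^sub>F T::real in at_top. second_moment t1 \<le> ln T * T powr (1 - 1/2)" by real_asymp
  then show ?thesis
    using eventually_ge_at_top[of t1] ladder_lower_bound[of "1/2", simplified]
  proof eventually_elim
    case (elim T)
    have lnT: "ln T > 0" using elim t1 by simp
    have "2 * ln T * \<Phi> t1 - second_moment t1 \<le> 2 * ln T * \<Phi> T - second_moment T"
    proof (rule DERIV_nonneg_imp_nondecreasing[of t1 T])
      fix t assume t: "t1 \<le> t" "t \<le> T"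
      have "ln t \<le> ln T" "ln t > 0" using t t1(1) by auto
      then have "\<omega> t \<le> 2 * ln T" "\<omega> t > 0" using t1(3,4)[of t] t by linarith+
      then have "zeta_sq t \<le> 2 * ln T * (zeta_sq t / \<omega> t)"
        using mult_right_mono[of "\<omega> t" "2 * ln T" "zeta_sq t"] by (simp add: field_simps)
      moreover have "((\<lambda>t. 2 * ln T * \<Phi> t - second_moment t) has_real_derivative
          2 * ln T * (zeta_sq t / \<omega> t) - zeta_sq t) (at t)"
        using t t1(1) by (intro DERIV_diff DERIV_cmult t1(2) second_moment_derivative) auto
      ultimately show "\<exists>y. ((\<lambda>t. 2 * ln T * \<Phi> t - second_moment t) has_real_derivative y) (at t) \<and> 0 \<le> y"
        by (intro exI conjI) auto
    qed (use elim in auto)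
    moreover have "2 * ln T * \<Phi> t1 > 0" using lnT t1 by simp
    moreover have "ln T * T powr (1 - 1/2) \<le> ln T * \<Phi> T"
      using elim lnT by (intro mult_left_mono) auto
    ultimately show ?case using elim by simp
  qed
qed

text \<open>The two preceding inequalities bound the second moment at \<open>X = \<Phi> T\<close> by \<open>9 * X * ln T\<close>, and the lower bound
  for the ladder replaces \<open>ln T\<close> by \<open>2 * ln X\<close>. Every large \<open>X\<close> is a value of the ladder.\<close>
lemma second_moment_upper_bound: "\<forall>\<^sub>F X in at_top. second_moment X \<le> 18 * X * ln X"
proof -
  have "\<forall>\<^sub>F T in at_top. second_moment (\<Phi> T) \<le> 18 * \<Phi> T * ln (\<Phi> T)"
    using second_moment_ladder_le second_moment_le_ladder ladder_lower_bound[of "1/2", simplified] eventually_gt_at_top[of 1]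
  proof eventually_elim
    case (elim T)
    have "T powr (1/2) > 0" using elim by simp
    then have pos: "\<Phi> T > 0" using elim by linarith
    then have "ln (T powr (1/2)) \<le> ln (\<Phi> T)" using elim by (subst ln_le_cancel_iff) auto
    then have "ln T \<le> 2 * ln (\<Phi> T)" using elim by (simp add: ln_powr)
    then have "3 * (3 * ln T * \<Phi> T) \<le> 3 * (3 * (2 * ln (\<Phi> T)) * \<Phi> T)"
      using pos by (intro mult_left_mono mult_right_mono) auto
    then show ?case using elim by (simp add: algebra_simps)
  qed
  from eventually_compose_filterlim[OF this inverse_at_top] inverse_beyond[of 0]
  show ?thesis by eventually_elim simp
qed

text \<open>Since \<open>\<omega> \<ge> 1/2\<close>, the ladder grows at most twice as fast as the second moment, which is \<open>O (T ln T)\<close>.\<close>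
lemma ladder_upper_bound:
  assumes "e > 0"
  shows "\<forall>\<^sub>F T in at_top. \<Phi> T \<le> T powr (1 + e)"
proof -
  obtain t1 where t1: "t1 \<ge> 3"
    "\<And>t. t \<ge> t1 \<Longrightarrow> (\<Phi> has_real_derivative zeta_sq t / \<omega> t) (at t)"
    "\<And>t. t \<ge> t1 \<Longrightarrow> ln t / 2 \<le> \<omega> t"
    using regular_ray by auto
  have "\<forall>\<^sub>F T::real in at_top. c + 36 * T * ln T < T powr (1 + e)" for c
    using assms by real_asymp
  from this[of "\<Phi> t1"] show ?thesis using eventually_ge_at_top[of t1] second_moment_upper_bound
  proof eventually_elim
    case (elim T)
    have "2 * second_moment t1 - \<Phi> t1 \<le> 2 * second_moment T - \<Phi> T"
    proof (rule DERIV_nonneg_imp_nondecreasing[of t1 T])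
      fix t assume t: "t1 \<le> t" "t \<le> T"
      \<comment> \<open>The ray starts at 3, which exceeds e.\<close>
      have "ln t \<ge> ln (exp 1)"
        using t t1(1) exp_le by (subst ln_le_cancel_iff) auto
      then have "\<omega> t \<ge> 1/2" using t1(3)[of t] t by simp
      then have "zeta_sq t / \<omega> t \<le> zeta_sq t / (1/2)"
        by (intro divide_left_mono) auto
      moreover have "((\<lambda>t. 2 * second_moment t - \<Phi> t) has_real_derivative
          2 * zeta_sq t - zeta_sq t / \<omega> t) (at t)"
        using t t1(1) by (intro DERIV_diff DERIV_cmult t1(2) second_moment_derivative) auto
      ultimately show "\<exists>y. ((\<lambda>t. 2 * second_moment t - \<Phi> t) has_real_derivative y) (at t) \<and> 0 \<le> y"
        by (intro exI conjI) auto
    qed (use elim in auto)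
    moreover have "second_moment t1 \<ge> 0"
      by (auto simp: second_moment_def intro!: integral_nonneg integrable_zeta_sq)
    ultimately show ?case using elim by simp
  qed
qed

lemma ln_ladder_ratio: "((\<lambda>T. ln (\<Phi> T) / ln T) \<longlongrightarrow> 1) at_top"
proof (rule tendstoI)
  fix e :: real assume "e > 0"
  define d where "d = min (e / 2) (1 / 2)"
  have d: "0 < d" "d < 1" "d < e" using \<open>e > 0\<close> by (auto simp: d_def)
  show "\<forall>\<^sub>F T in at_top. dist (ln (\<Phi> T) / ln T) 1 < e"
    using ladder_lower_bound[OF d(1,2)] ladder_upper_bound[OF d(1)] eventually_gt_at_top[of 1]
  proof eventually_elim
    case (elim T)
    have "T powr (1 - d) > 0" using elim by simp
    with elim have pos: "\<Phi> T > 0" by linarith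
    have lnT: "ln T > 0" using elim by simp
    have "ln (T powr (1 - d)) \<le> ln (\<Phi> T)" "ln (\<Phi> T) \<le> ln (T powr (1 + d))"
      using elim pos by (subst ln_le_cancel_iff; simp)+
    then have "(1 - d) * ln T \<le> ln (\<Phi> T)" "ln (\<Phi> T) \<le> (1 + d) * ln T"
      using elim by (simp_all add: ln_powr)
    then have "1 - d \<le> ln (\<Phi> T) / ln T" "ln (\<Phi> T) / ln T \<le> 1 + d"
      using lnT by (simp_all add: field_simps)
    then show ?case using d by (simp add: dist_real_def)
  qed
qed

section \<open>Reverse iterates and factorization points\<close>

abbreviation iterate :: "nat \<Rightarrow> real \<Rightarrow> real" where "iterate \<equiv> reverse_iterate \<phi> t0"

lemma iterate_0 [simp]: "iterate 0 x = x"
  and iterate_Suc: "iterate (Suc r) x = \<Psi> (iterate r x)"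
  and iterate_Suc_shift: "iterate (Suc r) x = iterate r (\<Psi> x)"
  by (simp_all add: reverse_iterate_def funpow_swap1)

lemma iterate_at_top: "filterlim (iterate r) at_top at_top"
proof (induction r)
  case 0
  show ?case by (simp add: filterlim_ident reverse_iterate_def)
next
  case (Suc r)
  show ?case using filterlim_compose[OF inverse_at_top Suc] by (simp add: iterate_Suc)
qed

text \<open>The logarithmic comparison \<open>ln (\<Phi> T) \<sim> ln T\<close> passes to the inverse and to all its iterates; this is the
  precision needed for \<open>\<omega>\<close>, which behaves like a logarithm.\<close>
lemma ln_inverse_ratio: "((\<lambda>x. ln (\<Psi> x) / ln x) \<longlongrightarrow> 1) at_top"
proof -
  have "((\<lambda>x. ln (\<Phi> (\<Psi> x)) / ln (\<Psi> x)) \<longlongrightarrow> 1) at_top"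
    by (rule filterlim_compose[OF ln_ladder_ratio inverse_at_top])
  moreover have "\<forall>\<^sub>F x in at_top. ln (\<Phi> (\<Psi> x)) / ln (\<Psi> x) = ln x / ln (\<Psi> x)"
    using inverse_beyond[of 0] by eventually_elim simp
  ultimately have "((\<lambda>x. ln x / ln (\<Psi> x)) \<longlongrightarrow> 1) at_top"
    by (rule Lim_transform_eventually)
  from tendsto_inverse[OF this] show ?thesis by simp
qed

lemma ln_iterate_ratio: "((\<lambda>x. ln (iterate r x) / ln x) \<longlongrightarrow> 1) at_top"
proof (induction r)
  case 0
  have "\<forall>\<^sub>F x::real in at_top. ln x / ln x = 1"
    using eventually_gt_at_top[of 1] by eventually_elim simp
  then show ?case by (simp add: tendsto_eventually)
next
  case (Suc r)
  have "((\<lambda>x. ln (\<Psi> (iterate r x)) / ln (iterate r x) * (ln (iterate r x) / ln x)) \<longlongrightarrow> 1) at_top"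
    using tendsto_mult[OF filterlim_compose[OF ln_inverse_ratio iterate_at_top[of r]] Suc] by simp
  moreover have "\<forall>\<^sub>F x in at_top. iterate r x > 1"
    using iterate_at_top[of r] by (simp add: filterlim_at_top_dense)
  then have "\<forall>\<^sub>F x in at_top. ln (\<Psi> (iterate r x)) / ln (iterate r x) * (ln (iterate r x) / ln x)
      = ln (iterate (Suc r) x) / ln x"
    by eventually_elim (simp add: iterate_Suc)
  ultimately show ?case by (rule Lim_transform_eventually)
qed

abbreviation dladder :: "real \<Rightarrow> real" where "dladder \<equiv> tilde_zeta_sq \<phi>"

text \<open>The mean value theorem for \<open>H\<close> composed with the \<open>k\<close>-fold ladder. The induction replaces
  \<open>[a, b]\<close> and \<open>H\<close> by their pullbacks under one step of the ladder, and the chain rule contributes the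
  factor \<open>\<Phi>' \<alpha>\<^sub>1\<close>; this is why \<open>H\<close>, \<open>a\<close> and \<open>b\<close> are arbitrary in it.\<close>
lemma iterated_mean_value:
  assumes t1: "t1 \<ge> t0" "\<And>t. t \<ge> t1 \<Longrightarrow> (\<Phi> has_real_derivative dladder t) (at t)"
    and x0: "\<And>x. x \<ge> x0 \<Longrightarrow> \<Psi> x \<ge> t1 \<and> \<Phi> (\<Psi> x) = x"
    and "a < b" and "\<And>r. r < k \<Longrightarrow> iterate r a \<ge> x0"
    and "\<And>x. a \<le> x \<Longrightarrow> x \<le> b \<Longrightarrow> (H has_real_derivative f x) (at x)"
  shows "iterate k a < iterate k b \<and> (\<exists>\<alpha>. \<alpha> 0 \<in> {a<..<b} \<and>
    (\<forall>r\<in>{1..k}. \<alpha> r \<in> {iterate r a<..<iterate r b}) \<and>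
    H b - H a = (iterate k b - iterate k a) * (f (\<alpha> 0) * (\<Prod>r=1..k. dladder (\<alpha> r))))"
  using assms(4-6)
proof (induction k arbitrary: a b H f)
  case 0
  obtain z where "z > a" "z < b" "H b - H a = (b - a) * f z"
    using MVT2[of a b H f] 0 by blast
  then show ?case using \<open>a < b\<close> by (auto intro!: exI[of _ "\<lambda>_. z"])
next
  case (Suc k)
  have "a \<ge> x0" using Suc.prems(2)[of 0] by simp
  then have inv: "\<Psi> a \<ge> t1" "\<Phi> (\<Psi> a) = a" "\<Psi> b \<ge> t1" "\<Phi> (\<Psi> b) = b"
    using x0[of a] x0[of b] \<open>a < b\<close> by auto
  have mono: "\<Phi> s < \<Phi> t" if "s < t" "s \<ge> t1" for s t
    using that t1(1) by (intro strict_mono_onD[OF increasing]) auto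
  have mono_le: "\<Phi> s \<le> \<Phi> t" if "s \<le> t" "s \<ge> t1" for s t
    using mono[of s t] that by (cases "s = t") auto
  have "\<Psi> a < \<Psi> b"
    using mono[of "\<Psi> b" "\<Psi> a"] inv \<open>a < b\<close> by (cases "\<Psi> a" "\<Psi> b" rule: linorder_cases) auto
  have deriv: "((\<lambda>x. H (\<Phi> x)) has_real_derivative f (\<Phi> x) * dladder x) (at x)"
    if "\<Psi> a \<le> x" "x \<le> \<Psi> b" for x
  proof -
    have "\<Phi> (\<Psi> a) \<le> \<Phi> x" "\<Phi> x \<le> \<Phi> (\<Psi> b)"
      using that inv by (intro mono_le; linarith)+
    then have "a \<le> \<Phi> x" "\<Phi> x \<le> b" using inv by simp_all
    then show ?thesis
      using that inv by (intro DERIV_chain2[OF Suc.prems(3) t1(2)]) auto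
  qed
  obtain \<alpha> where lt: "iterate k (\<Psi> a) < iterate k (\<Psi> b)"
    and \<alpha>: "\<alpha> 0 \<in> {\<Psi> a<..<\<Psi> b}"
      "\<And>r. r \<in> {1..k} \<Longrightarrow> \<alpha> r \<in> {iterate r (\<Psi> a)<..<iterate r (\<Psi> b)}"
      "H (\<Phi> (\<Psi> b)) - H (\<Phi> (\<Psi> a)) = (iterate k (\<Psi> b) - iterate k (\<Psi> a)) *
        (f (\<Phi> (\<alpha> 0)) * dladder (\<alpha> 0) * (\<Prod>r=1..k. dladder (\<alpha> r)))"
    using Suc.IH[OF \<open>\<Psi> a < \<Psi> b\<close> _ deriv] Suc.prems(2)[of "Suc _"]
    by (auto simp: iterate_Suc_shift)
  \<comment> \<open>The points for the pulled-back interval move up by one index, and the new point number 0 is the image of the old one.\<close>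
  define \<alpha>' where "\<alpha>' = case_nat (\<Phi> (\<alpha> 0)) \<alpha>"
  have \<alpha>'_Suc: "\<alpha>' (Suc r) = \<alpha> r" and \<alpha>'_0: "\<alpha>' 0 = \<Phi> (\<alpha> 0)" for r
    by (simp_all add: \<alpha>'_def)
  show ?case
  proof (intro conjI exI[of _ \<alpha>'] ballI)
    show "iterate (Suc k) a < iterate (Suc k) b" using lt by (simp add: iterate_Suc_shift)
    show "\<alpha>' 0 \<in> {a<..<b}"
      using mono[of "\<Psi> a" "\<alpha> 0"] mono[of "\<alpha> 0" "\<Psi> b"] \<alpha>(1) inv by (auto simp: \<alpha>'_0)
    show "\<alpha>' r \<in> {iterate r a<..<iterate r b}" if r: "r \<in> {1..Suc k}" for r
    proof -
      obtain q where q: "r = Suc q" "q \<le> k" using r by (cases r) auto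
      show ?thesis using \<alpha>(1) \<alpha>(2)[of q] q
        by (cases q) (auto simp: \<alpha>'_Suc iterate_Suc_shift)
    qed
    have "(\<Prod>r=1..Suc k. dladder (\<alpha>' r)) = (\<Prod>r=0..k. dladder (\<alpha> r))"
      using prod.atLeast_Suc_atMost_Suc_shift[of "\<lambda>r. dladder (\<alpha>' r)" 0 k]
      by (simp add: o_def \<alpha>'_Suc)
    also have "\<dots> = dladder (\<alpha> 0) * (\<Prod>r=1..k. dladder (\<alpha> r))"
      by (simp add: prod.atLeast_Suc_atMost)
    finally show "H b - H a = (iterate (Suc k) b - iterate (Suc k) a) *
        (f (\<alpha>' 0) * (\<Prod>r=1..Suc k. dladder (\<alpha>' r)))"
      using \<alpha>(3) inv by (simp add: \<alpha>'_0 iterate_Suc_shift mult_ac)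
  qed
qed

lemma dladder:
  "\<forall>\<^sub>F t in at_top. (\<Phi> has_real_derivative dladder t) (at t) \<and> zeta_sq t = dladder t * \<omega> t"
proof -
  obtain t1 where t1: "t1 \<ge> 3" "\<And>t. t \<ge> t1 \<Longrightarrow> (\<Phi> has_real_derivative zeta_sq t / \<omega> t) (at t)"
     "\<And>t. t \<ge> t1 \<Longrightarrow> ln t / 2 \<le> \<omega> t"
    using regular_ray by auto
  show ?thesis using eventually_ge_at_top[of t1]
  proof eventually_elim
    case (elim t)
    have "ln t > 0" using elim t1(1) by simp
    then have "\<omega> t > 0" using t1(3)[OF elim] by linarith
    moreover have "dladder t = zeta_sq t / \<omega> t"
      using t1(2)[OF elim] by (simp add: tilde_zeta_sq_def DERIV_imp_deriv)
    ultimately show ?case using t1(2)[OF elim] by simp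
  qed
qed

text \<open>The points \<open>\<beta>\<close> come from the identity function as primitive, hence are common to all \<open>f\<close>. The mean value
  identity itself is kept in the conclusion: it is the form in which the points enter the asymptotics.\<close>
lemma factorization_points_exist:
  assumes U: "U > 0"
  shows "\<forall>\<^sub>F T in at_top. iterate k T < iterate k (T + U) \<and>
    (\<exists>\<beta>. \<forall>f H. continuous_on {T..T + U} f \<longrightarrow> (\<forall>t\<in>{T..T + U}. f t \<ge> 0) \<longrightarrow>
      (\<forall>t. (H has_real_derivative f t) (at t)) \<longrightarrow> H (T + U) - H T \<noteq> 0 \<longrightarrow>
      (\<exists>\<alpha>. zeta_factorization_points \<phi> t0 U T k f \<alpha> \<beta> \<and>
        H (T + U) - H T = (iterate k (T + U) - iterate k T) *
          (f (\<alpha> 0) * (\<Prod>r=1..k. dladder (\<alpha> r)))))"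
proof -
  obtain t2 where t2: "\<And>t. t \<ge> t2 \<Longrightarrow> (\<Phi> has_real_derivative dladder t) (at t)"
    using dladder unfolding eventually_at_top_linorder by blast
  define t1 where "t1 = max t0 t2"
  have t1: "t1 \<ge> t0" "\<And>t. t \<ge> t1 \<Longrightarrow> (\<Phi> has_real_derivative dladder t) (at t)"
    using t2 by (auto simp: t1_def)
  obtain x0 where x0: "\<And>x. x \<ge> x0 \<Longrightarrow> \<Psi> x \<ge> t1 \<and> \<Phi> (\<Psi> x) = x"
    using inverse_beyond[of t1] unfolding eventually_at_top_linorder by blast
  have "\<forall>\<^sub>F T in at_top. \<forall>r\<in>{..<k}. iterate r T \<ge> x0"
    using iterate_at_top by (intro eventually_ball_finite) (auto simp: filterlim_at_top)
  then show ?thesis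
  proof eventually_elim
    case (elim T)
    let ?len = "iterate k (T + U) - iterate k T"
    have TU: "T < T + U" using U by simp
    have mv: "iterate k T < iterate k (T + U) \<and> (\<exists>\<alpha>. \<alpha> 0 \<in> {T<..<T + U} \<and>
      (\<forall>r\<in>{1..k}. \<alpha> r \<in> {iterate r T<..<iterate r (T + U)}) \<and>
      H (T + U) - H T = ?len * (f (\<alpha> 0) * (\<Prod>r=1..k. dladder (\<alpha> r))))"
      if "\<And>t. (H has_real_derivative f t) (at t)" for H f
      by (rule iterated_mean_value[of t1 x0]) (use t1 x0 TU elim that in simp_all)
    from mv[OF DERIV_ident] obtain \<beta> where len: "iterate k T < iterate k (T + U)"
      and \<beta>: "\<forall>r\<in>{1..k}. \<beta> r \<in> {iterate r T<..<iterate r (T + U)}"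
        "(T + U) - T = ?len * (1 * (\<Prod>r=1..k. dladder (\<beta> r)))"
      by blast
    then have \<beta>_prod: "U = ?len * (\<Prod>r=1..k. dladder (\<beta> r))" by simp
    show ?case
    proof (rule conjI[OF len], rule exI[of _ \<beta>], intro allI impI)
      fix f H
      assume f: "continuous_on {T..T + U} f" "\<forall>t\<in>{T..T + U}. f t \<ge> 0"
        and H: "\<forall>t. (H has_real_derivative f t) (at t)" "H (T + U) - H T \<noteq> 0"
      from mv[of H f] H(1) obtain \<alpha> where \<alpha>: "\<alpha> 0 \<in> {T<..<T + U}"
        "\<forall>r\<in>{1..k}. \<alpha> r \<in> {iterate r T<..<iterate r (T + U)}"
        "H (T + U) - H T = ?len * (f (\<alpha> 0) * (\<Prod>r=1..k. dladder (\<alpha> r)))"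
        by blast
      have "(f has_integral H (T + U) - H T) {T..T + U}"
        using H(1) TU by (intro fundamental_theorem_of_calculus)
          (auto simp: has_real_derivative_iff_has_vector_derivative[symmetric]
            intro: has_field_derivative_at_within)
      then have int: "integral {T..T + U} f = H (T + U) - H T" by (rule integral_unique)
      have f0: "f (\<alpha> 0) \<noteq> 0" using \<alpha>(3) H(2) by auto
      have P\<beta>: "(\<Prod>r=1..k. dladder (\<beta> r)) = U / ?len" using \<beta>_prod len by (simp add: field_simps)
      have "(\<Prod>r=1..k. dladder (\<beta> r)) \<noteq> 0" using \<beta>_prod U by (metis less_irrefl mult_zero_right)
      then have \<beta>0: "dladder (\<beta> r) \<noteq> 0" if "r \<in> {1..k}" for r
        using that by (metis finite_atLeastAtMost prod_zero_iff)
      have "(\<Prod>r=1..k. dladder (\<alpha> r) / dladder (\<beta> r)) =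
          (\<Prod>r=1..k. dladder (\<alpha> r)) / (U / ?len)"
        by (simp only: prod_dividef P\<beta>)
      also have "\<dots> = 1 / f (\<alpha> 0) * (1 / U * integral {T..T + U} f)"
        unfolding int \<alpha>(3) using f0 U len by (simp add: field_simps)
      finally have "zeta_factorization_points \<phi> t0 U T k f \<alpha> \<beta>"
        unfolding zeta_factorization_points_def using f \<alpha>(1,2) \<beta>(1) \<beta>0 f0
        by (auto intro!: bexI[of _ "\<alpha> 0"])
      then show "\<exists>\<alpha>. zeta_factorization_points \<phi> t0 U T k f \<alpha> \<beta> \<and>
          H (T + U) - H T = ?len * (f (\<alpha> 0) * (\<Prod>r=1..k. dladder (\<alpha> r)))"
        using \<alpha>(3) by blast
    qed
  qed
qed

text \<open>Between the iterates of \<open>T\<close> and of \<open>T + U\<close> the logarithm is squeezed between two quantities asymptotic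
  to \<open>ln T\<close>.\<close>
lemma omega_between_iterates:
  fixes T \<alpha> :: "nat \<Rightarrow> real"
  assumes T: "filterlim T at_top sequentially"
    and \<alpha>: "\<forall>\<^sub>F L in sequentially. \<alpha> L \<in> {iterate r (T L)<..<iterate r (T L + U)}"
  shows "(\<lambda>L. \<omega> (\<alpha> L) / ln (T L)) \<longlonglongrightarrow> 1"
    and "filterlim \<alpha> at_top sequentially"
proof -
  have TU: "filterlim (\<lambda>L. T L + U) at_top sequentially"
    using filterlim_tendsto_add_at_top[OF tendsto_const T, of U] by (simp add: add.commute)
  show \<alpha>_top: "filterlim \<alpha> at_top sequentially"
    using filterlim_compose[OF iterate_at_top[of r] T] \<alpha>
    by (rule filterlim_at_top_mono[OF _ eventually_mono]) auto
  have lower: "(\<lambda>L. ln (iterate r (T L)) / ln (T L)) \<longlonglongrightarrow> 1"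
    by (rule filterlim_compose[OF ln_iterate_ratio T])
  have "((\<lambda>x::real. ln (x + U) / ln x) \<longlongrightarrow> 1) at_top" by real_asymp
  from tendsto_mult[OF filterlim_compose[OF ln_iterate_ratio[of r] TU] filterlim_compose[OF this T]]
  have "(\<lambda>L. ln (iterate r (T L + U)) / ln (T L + U) * (ln (T L + U) / ln (T L))) \<longlonglongrightarrow> 1"
    by simp
  moreover have "\<forall>\<^sub>F L in sequentially. T L + U > 1"
    using TU by (simp add: filterlim_at_top_dense)
  then have "\<forall>\<^sub>F L in sequentially. ln (iterate r (T L + U)) / ln (T L + U) * (ln (T L + U) / ln (T L))
      = ln (iterate r (T L + U)) / ln (T L)"
    by eventually_elim simp
  ultimately have upper: "(\<lambda>L. ln (iterate r (T L + U)) / ln (T L)) \<longlonglongrightarrow> 1"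
    by (rule Lim_transform_eventually)
  have T1: "\<forall>\<^sub>F L in sequentially. T L > 1" using T by (simp add: filterlim_at_top_dense)
  have it0: "\<forall>\<^sub>F L in sequentially. iterate r (T L) > 0"
    using filterlim_compose[OF iterate_at_top[of r] T] by (simp add: filterlim_at_top_dense)
  have ln\<alpha>: "(\<lambda>L. ln (\<alpha> L) / ln (T L)) \<longlonglongrightarrow> 1"
  proof (rule tendsto_sandwich[OF _ _ lower upper])
    show "\<forall>\<^sub>F L in sequentially. ln (iterate r (T L)) / ln (T L) \<le> ln (\<alpha> L) / ln (T L)"
      using \<alpha> T1 it0 by eventually_elim (auto intro!: divide_right_mono)
    show "\<forall>\<^sub>F L in sequentially. ln (\<alpha> L) / ln (T L) \<le> ln (iterate r (T L + U)) / ln (T L)"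
      using \<alpha> T1 it0 by eventually_elim (auto intro!: divide_right_mono)
  qed
  from tendsto_mult[OF filterlim_compose[OF omega_ratio \<alpha>_top] this]
  have "(\<lambda>L. \<omega> (\<alpha> L) / ln (\<alpha> L) * (ln (\<alpha> L) / ln (T L))) \<longlonglongrightarrow> 1" by simp
  moreover have "\<forall>\<^sub>F L in sequentially. \<alpha> L > 1" using \<alpha>_top by (simp add: filterlim_at_top_dense)
  then have "\<forall>\<^sub>F L in sequentially. \<omega> (\<alpha> L) / ln (\<alpha> L) * (ln (\<alpha> L) / ln (T L)) = \<omega> (\<alpha> L) / ln (T L)"
    by eventually_elim simp
  ultimately show "(\<lambda>L. \<omega> (\<alpha> L) / ln (T L)) \<longlonglongrightarrow> 1"
    by (rule Lim_transform_eventually)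
qed

text \<open>The mean value identity, multiplied by the values of \<open>\<omega>\<close> at the points, expresses the zeta product
  through \<open>I / T\<close>; the correction factors \<open>T / \<alpha>\<^sub>0\<close> and \<open>\<omega> \<alpha>\<^sub>r / ln T\<close> tend to \<open>1\<close>. The normalizing
  factor on the left is the same for every \<open>g\<close>.\<close>
lemma normalized_zeta_product_limit:
  fixes T I :: "nat \<Rightarrow> real" and \<alpha> :: "nat \<Rightarrow> nat \<Rightarrow> real" and \<beta> :: "nat \<Rightarrow> nat \<Rightarrow> real"
  assumes T: "filterlim T at_top sequentially"
    and points: "\<forall>\<^sub>F L in sequentially.
      zeta_factorization_points \<phi> t0 U (T L) k (\<lambda>t. t * g t) (\<alpha> L) (\<beta> L)"
    and mean_value: "\<forall>\<^sub>F L in sequentially.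
      I L = (iterate k (T L + U) - iterate k (T L)) *
        (\<alpha> L 0 * g (\<alpha> L 0) * (\<Prod>r=1..k. dladder (\<alpha> L r)))"
    and I: "(\<lambda>L. I L / T L) \<longlonglongrightarrow> J"
  shows "(\<lambda>L. (iterate k (T L + U) - iterate k (T L)) / ln (T L) ^ k *
    ((\<Prod>r=1..k. zeta_sq (\<alpha> L r)) * g (\<alpha> L 0))) \<longlonglongrightarrow> J"
proof -
  have between: "\<forall>\<^sub>F L in sequentially. \<alpha> L r \<in> {iterate r (T L)<..<iterate r (T L + U)}" if "r \<in> {1..k}" for r
    using points by eventually_elim (use that in \<open>auto simp: zeta_factorization_points_def\<close>)
  have \<omega>: "(\<lambda>L. \<Prod>r=1..k. \<omega> (\<alpha> L r) / ln (T L)) \<longlonglongrightarrow> (\<Prod>r=1..k. 1)"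
    by (intro tendsto_prod omega_between_iterates(1)[OF T between])
  have "\<forall>\<^sub>F L in sequentially. \<forall>r\<in>{1..k}. zeta_sq (\<alpha> L r) = dladder (\<alpha> L r) * \<omega> (\<alpha> L r)"
  proof (intro eventually_ball_finite ballI)
    fix r assume "r \<in> {1..k}"
    from eventually_compose_filterlim[OF dladder omega_between_iterates(2)[OF T between[OF this]]]
    show "\<forall>\<^sub>F L in sequentially. zeta_sq (\<alpha> L r) = dladder (\<alpha> L r) * \<omega> (\<alpha> L r)"
      by eventually_elim simp
  qed simp
  moreover have T0: "\<forall>\<^sub>F L in sequentially. T L > 1" using T by (simp add: filterlim_at_top_dense)
  moreover have \<alpha>0: "\<forall>\<^sub>F L in sequentially. \<alpha> L 0 \<in> {T L<..<T L + U}"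
    using points by eventually_elim (simp add: zeta_factorization_points_def)
  ultimately have eq: "\<forall>\<^sub>F L in sequentially.
      I L / T L * (T L / \<alpha> L 0) * (\<Prod>r=1..k. \<omega> (\<alpha> L r) / ln (T L)) =
      (iterate k (T L + U) - iterate k (T L)) / ln (T L) ^ k *
        ((\<Prod>r=1..k. zeta_sq (\<alpha> L r)) * g (\<alpha> L 0))"
    using mean_value
  proof eventually_elim
    case (elim L)
    have "(\<Prod>r=1..k. zeta_sq (\<alpha> L r)) = (\<Prod>r=1..k. dladder (\<alpha> L r)) * (\<Prod>r=1..k. \<omega> (\<alpha> L r))"
      using elim by (simp flip: prod.distrib)
    then show ?case using elim by (simp add: prod_dividef)
  qed
  have ratio: "(\<lambda>L. T L / \<alpha> L 0) \<longlonglongrightarrow> 1"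
  proof (rule tendsto_sandwich)
    show "\<forall>\<^sub>F L in sequentially. T L / (T L + U) \<le> T L / \<alpha> L 0"
      using \<alpha>0 T0 by eventually_elim (auto intro!: divide_left_mono)
    show "\<forall>\<^sub>F L in sequentially. T L / \<alpha> L 0 \<le> 1"
      using \<alpha>0 T0 by eventually_elim simp
    have "((\<lambda>x::real. x / (x + U)) \<longlongrightarrow> 1) at_top" by real_asymp
    from filterlim_compose[OF this T] show "(\<lambda>L. T L / (T L + U)) \<longlonglongrightarrow> 1" .
  qed simp
  have "(\<lambda>L. I L / T L * (T L / \<alpha> L 0) * (\<Prod>r=1..k. \<omega> (\<alpha> L r) / ln (T L)))
      \<longlonglongrightarrow> J * 1 * (\<Prod>r=1..k. 1)"
    by (intro tendsto_mult I ratio \<omega>)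
  from Lim_transform_eventually[OF this eq] show ?thesis by simp
qed

end

section \<open>The three weights on a window after a multiple of pi\<close>

text \<open>The three weights have explicit primitives, whose increments divided by \<open>T\<close> tend to
  \<open>U / 2 - J / 2\<close>, \<open>U / 2 + J / 2\<close> and \<open>J\<close> with \<open>J = sin (2 U) / 2\<close>. The condition \<open>U < \<pi> / 4\<close> makes
  \<open>cos (2 t)\<close> nonnegative on the window.\<close>
theorem corollary2:
  fixes \<mu> \<phi> \<omega> :: "real \<Rightarrow> real" and y0 t0 U :: real and k0 k :: nat
  assumes weight: "ladder_weight y0 \<mu>"
    and ladder: "solves_ladder_equation y0 \<mu> \<phi>"
    and increasing: "strict_mono_on {t0..} (jacobs_ladder \<phi>)"
    and derivative: "\<forall>\<^sub>F t in at_top.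
          (jacobs_ladder \<phi> has_real_derivative zeta_sq t / \<omega> t) (at t)"
    and omega: "(\<lambda>t. \<omega> t / ln t - 1) \<in> O[at_top](\<lambda>t. ln (ln t) / ln t)"
    and k: "1 \<le> k" "k \<le> k0"
    and U: "0 < U" "U < pi / 4"
  shows "\<exists>\<alpha>1 \<alpha>2 \<alpha>3 \<beta> :: nat \<Rightarrow> nat \<Rightarrow> real.
    (\<forall>\<^sub>F L in sequentially.
       zeta_factorization_points \<phi> t0 U (pi * real L) k (\<lambda>t. t * (sin t)\<^sup>2) (\<alpha>1 L) (\<beta> L) \<and>
       zeta_factorization_points \<phi> t0 U (pi * real L) k (\<lambda>t. t * (cos t)\<^sup>2) (\<alpha>2 L) (\<beta> L) \<and>
       zeta_factorization_points \<phi> t0 U (pi * real L) k (\<lambda>t. t * cos (2 * t)) (\<alpha>3 L) (\<beta> L)) \<and>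
    (\<lambda>L. ((\<Prod>r=1..k. (cmod (riemann_zeta (1/2 + \<i> * of_real (\<alpha>2 L r))))\<^sup>2) * (cos (\<alpha>2 L 0))\<^sup>2
          - (\<Prod>r=1..k. (cmod (riemann_zeta (1/2 + \<i> * of_real (\<alpha>1 L r))))\<^sup>2) * (sin (\<alpha>1 L 0))\<^sup>2)
         / ((\<Prod>r=1..k. (cmod (riemann_zeta (1/2 + \<i> * of_real (\<alpha>3 L r))))\<^sup>2) * cos (2 * \<alpha>3 L 0)))
      \<longlonglongrightarrow> 1"
proof -
  interpret zeta_ladder \<mu> \<phi> \<omega> y0 t0
    by unfold_locales (fact weight ladder increasing derivative omega)+
  define T where "T L = pi * real L" for L :: nat
  define len where "len L = iterate k (T L + U) - iterate k (T L)" for L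
  define H3 where "H3 t = t * sin (2 * t) / 2 + cos (2 * t) / 4" for t :: real
  define H1 where "H1 t = t\<^sup>2 / 4 - H3 t / 2" for t :: real
  define H2 where "H2 t = t\<^sup>2 / 4 + H3 t / 2" for t :: real
  define J where "J = sin (2 * U) / 2"
  have H3: "(H3 has_real_derivative t * cos (2 * t)) (at t)" for t
    unfolding H3_def[abs_def] by (auto intro!: derivative_eq_intros simp: field_simps)
  have H1: "(H1 has_real_derivative t * (sin t)\<^sup>2) (at t)" for t
  proof -
    have "(H1 has_real_derivative 2 * t / 4 - t * cos (2 * t) / 2) (at t)"
      unfolding H1_def[abs_def] by (auto intro!: derivative_eq_intros H3)
    also have "2 * t / 4 - t * cos (2 * t) / 2 = t * (sin t)\<^sup>2"
      by (simp only: cos_double_sin) (simp add: field_simps)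
    finally show ?thesis .
  qed
  have H2: "(H2 has_real_derivative t * (cos t)\<^sup>2) (at t)" for t
  proof -
    have "(H2 has_real_derivative 2 * t / 4 + t * cos (2 * t) / 2) (at t)"
      unfolding H2_def[abs_def] by (auto intro!: derivative_eq_intros H3)
    also have "2 * t / 4 + t * cos (2 * t) / 2 = t * (cos t)\<^sup>2"
      by (simp only: cos_double_cos) (simp add: field_simps)
    finally show ?thesis .
  qed
  have T_top: "filterlim T at_top sequentially"
    unfolding T_def by (rule filterlim_tendsto_pos_mult_at_top[OF tendsto_const])
      (auto intro: filterlim_real_sequentially)
  have trig: "sin (2 * (T L + u)) = sin (2 * u)" "cos (2 * (T L + u)) = cos (2 * u)" for L u
    using sin_2npi[of L] cos_2npi[of L]
    by (simp_all add: T_def ring_distribs sin_add cos_add mult_ac)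
  have I3_eq: "H3 (T L + U) - H3 (T L) = T L * J + (U * J + (cos (2 * U) - 1) / 4)" for L
    using trig[of L U] trig[of L 0] by (simp add: H3_def J_def field_simps)
  have "((\<lambda>x::real. (x * J + (U * J + (cos (2 * U) - 1) / 4)) / x) \<longlongrightarrow> J) at_top"
    by real_asymp
  from filterlim_compose[OF this T_top]
  have I3: "(\<lambda>L. (H3 (T L + U) - H3 (T L)) / T L) \<longlonglongrightarrow> J" by (simp add: I3_eq)
  have "((\<lambda>x::real. ((x + U)\<^sup>2 - x\<^sup>2) / 4 / x) \<longlongrightarrow> U / 2) at_top" by real_asymp
  from filterlim_compose[OF this T_top]
  have sq: "(\<lambda>L. ((T L + U)\<^sup>2 - (T L)\<^sup>2) / 4 / T L) \<longlonglongrightarrow> U / 2" .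
  have I1: "(\<lambda>L. (H1 (T L + U) - H1 (T L)) / T L) \<longlonglongrightarrow> U / 2 - J / 2"
  proof -
    have "(H1 (T L + U) - H1 (T L)) / T L =
        ((T L + U)\<^sup>2 - (T L)\<^sup>2) / 4 / T L - (H3 (T L + U) - H3 (T L)) / T L / 2" for L
      by (simp add: H1_def diff_divide_distrib mult.commute)
    then show ?thesis
      using tendsto_diff[OF sq tendsto_divide[OF I3 tendsto_const[of 2]]] by simp
  qed
  have I2: "(\<lambda>L. (H2 (T L + U) - H2 (T L)) / T L) \<longlonglongrightarrow> U / 2 + J / 2"
  proof -
    have "(H2 (T L + U) - H2 (T L)) / T L =
        ((T L + U)\<^sup>2 - (T L)\<^sup>2) / 4 / T L + (H3 (T L + U) - H3 (T L)) / T L / 2" for L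
      by (simp add: H2_def diff_divide_distrib add_divide_distrib mult.commute)
    then show ?thesis
      using tendsto_add[OF sq tendsto_divide[OF I3 tendsto_const[of 2]]] by simp
  qed
  have J: "J > 0" "J < U"
  proof -
    show "J > 0" using U sin_gt_zero[of "2 * U"] by (simp add: J_def)
    have "J = sin U * cos U" by (simp add: J_def sin_double)
    also have "\<dots> \<le> U * cos U"
      using U sin_x_le_x[of U] by (intro mult_right_mono cos_ge_zero) auto
    also have "\<dots> < U * 1"
      using U cos_monotone_0_pi[of 0 U] by (intro mult_strict_left_mono) auto
    finally show "J < U" by simp
  qed
  \<comment> \<open>A positive limit of the normalized integral makes the integral nonzero, as the factorization points require.\<close>
  have nonzero: "\<forall>\<^sub>F L in sequentially. F L \<noteq> 0"
    if "(\<lambda>L. F L / T L) \<longlonglongrightarrow> c" "c > 0" for F :: "nat \<Rightarrow> real" and c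
    using order_tendstoD(1)[OF that] by eventually_elim auto
  have nonzero1: "\<forall>\<^sub>F L in sequentially. H1 (T L + U) - H1 (T L) \<noteq> 0"
    and nonzero2: "\<forall>\<^sub>F L in sequentially. H2 (T L + U) - H2 (T L) \<noteq> 0"
    and nonzero3: "\<forall>\<^sub>F L in sequentially. H3 (T L + U) - H3 (T L) \<noteq> 0"
    using J by (intro nonzero[OF I1] nonzero[OF I2] nonzero[OF I3]; simp)+
  have "\<forall>\<^sub>F L in sequentially. \<exists>\<beta> \<alpha>1 \<alpha>2 \<alpha>3. len L > 0 \<and>
      (zeta_factorization_points \<phi> t0 U (T L) k (\<lambda>t. t * (sin t)\<^sup>2) \<alpha>1 \<beta> \<and>
       zeta_factorization_points \<phi> t0 U (T L) k (\<lambda>t. t * (cos t)\<^sup>2) \<alpha>2 \<beta> \<and>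
       zeta_factorization_points \<phi> t0 U (T L) k (\<lambda>t. t * cos (2 * t)) \<alpha>3 \<beta>) \<and>
      H1 (T L + U) - H1 (T L) = len L * (\<alpha>1 0 * (sin (\<alpha>1 0))\<^sup>2 * (\<Prod>r=1..k. dladder (\<alpha>1 r))) \<and>
      H2 (T L + U) - H2 (T L) = len L * (\<alpha>2 0 * (cos (\<alpha>2 0))\<^sup>2 * (\<Prod>r=1..k. dladder (\<alpha>2 r))) \<and>
      H3 (T L + U) - H3 (T L) = len L * (\<alpha>3 0 * cos (2 * \<alpha>3 0) * (\<Prod>r=1..k. dladder (\<alpha>3 r)))"
    using eventually_compose_filterlim[OF factorization_points_exist[OF U(1), of k] T_top]
      nonzero1 nonzero2 nonzero3
  proof eventually_elim
    case (elim L)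
    have T0: "T L \<ge> 0" by (simp add: T_def)
    obtain \<beta> where \<beta>: "\<And>f H. continuous_on {T L..T L + U} f \<Longrightarrow> (\<And>t. t\<in>{T L..T L + U} \<Longrightarrow> f t \<ge> 0) \<Longrightarrow>
      (\<And>t. (H has_real_derivative f t) (at t)) \<Longrightarrow> H (T L + U) - H (T L) \<noteq> 0 \<Longrightarrow>
      (\<exists>\<alpha>. zeta_factorization_points \<phi> t0 U (T L) k f \<alpha> \<beta> \<and>
        H (T L + U) - H (T L) = len L * (f (\<alpha> 0) * (\<Prod>r=1..k. dladder (\<alpha> r))))"
      using elim(1) unfolding len_def by blast
    have "cos (2 * t) \<ge> 0" if t: "t \<in> {T L..T L + U}" for t
    proof -
      have "cos (2 * t) = cos (2 * (t - T L))" using trig(2)[of L "t - T L"] by simp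
      also have "\<dots> \<ge> 0" using t U by (intro cos_ge_zero) auto
      finally show ?thesis .
    qed
    then have "\<exists>\<alpha>. zeta_factorization_points \<phi> t0 U (T L) k (\<lambda>t. t * cos (2 * t)) \<alpha> \<beta> \<and>
        H3 (T L + U) - H3 (T L) = len L * (\<alpha> 0 * cos (2 * \<alpha> 0) * (\<Prod>r=1..k. dladder (\<alpha> r)))"
      using T0 elim J by (intro \<beta>[OF _ _ H3]) (auto intro!: continuous_intros)
    moreover have "\<exists>\<alpha>. zeta_factorization_points \<phi> t0 U (T L) k (\<lambda>t. t * (sin t)\<^sup>2) \<alpha> \<beta> \<and>
        H1 (T L + U) - H1 (T L) = len L * (\<alpha> 0 * (sin (\<alpha> 0))\<^sup>2 * (\<Prod>r=1..k. dladder (\<alpha> r)))"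
      using T0 elim J by (intro \<beta>[OF _ _ H1]) (auto intro!: continuous_intros)
    moreover have "\<exists>\<alpha>. zeta_factorization_points \<phi> t0 U (T L) k (\<lambda>t. t * (cos t)\<^sup>2) \<alpha> \<beta> \<and>
        H2 (T L + U) - H2 (T L) = len L * (\<alpha> 0 * (cos (\<alpha> 0))\<^sup>2 * (\<Prod>r=1..k. dladder (\<alpha> r)))"
      using T0 elim J by (intro \<beta>[OF _ _ H2]) (auto intro!: continuous_intros)
    moreover have "len L > 0" using elim(1) by (simp add: len_def)
    ultimately show ?case by blast
  qed
  then obtain \<beta> \<alpha>1 \<alpha>2 \<alpha>3 where ev: "\<forall>\<^sub>F L in sequentially. len L > 0 \<and>
      (zeta_factorization_points \<phi> t0 U (T L) k (\<lambda>t. t * (sin t)\<^sup>2) (\<alpha>1 L) (\<beta> L) \<and>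
       zeta_factorization_points \<phi> t0 U (T L) k (\<lambda>t. t * (cos t)\<^sup>2) (\<alpha>2 L) (\<beta> L) \<and>
       zeta_factorization_points \<phi> t0 U (T L) k (\<lambda>t. t * cos (2 * t)) (\<alpha>3 L) (\<beta> L)) \<and>
      H1 (T L + U) - H1 (T L) = len L * (\<alpha>1 L 0 * (sin (\<alpha>1 L 0))\<^sup>2 * (\<Prod>r=1..k. dladder (\<alpha>1 L r))) \<and>
      H2 (T L + U) - H2 (T L) = len L * (\<alpha>2 L 0 * (cos (\<alpha>2 L 0))\<^sup>2 * (\<Prod>r=1..k. dladder (\<alpha>2 L r))) \<and>
      H3 (T L + U) - H3 (T L) = len L * (\<alpha>3 L 0 * cos (2 * \<alpha>3 L 0) * (\<Prod>r=1..k. dladder (\<alpha>3 L r)))"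
    unfolding eventually_ex by blast
  define S where "S L = len L / ln (T L) ^ k" for L
  define A1 where "A1 L = (\<Prod>r=1..k. zeta_sq (\<alpha>1 L r)) * (sin (\<alpha>1 L 0))\<^sup>2" for L
  define A2 where "A2 L = (\<Prod>r=1..k. zeta_sq (\<alpha>2 L r)) * (cos (\<alpha>2 L 0))\<^sup>2" for L
  define A3 where "A3 L = (\<Prod>r=1..k. zeta_sq (\<alpha>3 L r)) * cos (2 * \<alpha>3 L 0)" for L
  have A1: "(\<lambda>L. S L * A1 L) \<longlonglongrightarrow> U / 2 - J / 2"
    unfolding S_def len_def A1_def
    by (rule normalized_zeta_product_limit[OF T_top _ _ I1])
      (use ev in \<open>auto simp: len_def elim: eventually_mono\<close>)
  have A2: "(\<lambda>L. S L * A2 L) \<longlonglongrightarrow> U / 2 + J / 2"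
    unfolding S_def len_def A2_def
    by (rule normalized_zeta_product_limit[OF T_top _ _ I2])
      (use ev in \<open>auto simp: len_def elim: eventually_mono\<close>)
  have A3: "(\<lambda>L. S L * A3 L) \<longlonglongrightarrow> J"
    unfolding S_def len_def A3_def
    by (rule normalized_zeta_product_limit[OF T_top _ _ I3])
      (use ev in \<open>auto simp: len_def elim: eventually_mono\<close>)
  have "(\<lambda>L. (S L * A2 L - S L * A1 L) / (S L * A3 L)) \<longlonglongrightarrow> (U / 2 + J / 2 - (U / 2 - J / 2)) / J"
    using J by (intro tendsto_divide tendsto_diff A1 A2 A3) auto
  also have "(U / 2 + J / 2 - (U / 2 - J / 2)) / J = 1" using J by simp
  finally have lim: "(\<lambda>L. (S L * A2 L - S L * A1 L) / (S L * A3 L)) \<longlonglongrightarrow> 1" .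
  have "\<forall>\<^sub>F L in sequentially. T L > 1" using T_top by (simp add: filterlim_at_top_dense)
  with ev have "\<forall>\<^sub>F L in sequentially. (S L * A2 L - S L * A1 L) / (S L * A3 L) = (A2 L - A1 L) / A3 L"
  proof eventually_elim
    case (elim L)
    then have "S L \<noteq> 0" by (simp add: S_def)
    then show ?case by (simp flip: right_diff_distrib)
  qed
  with lim have "(\<lambda>L. (A2 L - A1 L) / A3 L) \<longlonglongrightarrow> 1"
    by (rule Lim_transform_eventually)
  moreover have "\<forall>\<^sub>F L in sequentially.
       zeta_factorization_points \<phi> t0 U (pi * real L) k (\<lambda>t. t * (sin t)\<^sup>2) (\<alpha>1 L) (\<beta> L) \<and>
       zeta_factorization_points \<phi> t0 U (pi * real L) k (\<lambda>t. t * (cos t)\<^sup>2) (\<alpha>2 L) (\<beta> L) \<and>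
       zeta_factorization_points \<phi> t0 U (pi * real L) k (\<lambda>t. t * cos (2 * t)) (\<alpha>3 L) (\<beta> L)"
    using ev by eventually_elim (simp add: T_def)
  ultimately show ?thesis
    unfolding A1_def A2_def A3_def zeta_sq_def by blast
qed

end
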